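(* Let $v(0)\in\mathcal N^*$. (i) For every continuous $\lambda:[0,\infty)\to[0,\infty)$ with $\lambda(t)\ge\lambda_{\inf}>0$ for all $t$ (for some constant $\lambda_{\inf}$), the subcritical frozen percolation equations with initial condition $v(0)$ and rate function $\lambda$ have a unique solution. (ii) The critical frozen percolation equations with initial condition $v(0)$ have a unique solution. (iii) For every sequence of burning times $0=\beta_0<\beta_1<\beta_2<\dots$ with no accumulation point, the alternating equations with initial condition $v(0)$ and these burning times have a unique solution.
   Context: $\mathcal N$ is the set of sequences $v=(v_k)_{k\ge1}$ of nonnegative reals with $\sum_k v_k<\infty$; $\mathcal N^*\subset\mathcal N$ consists of those with only finitely many nonzero terms. For $v\in\mathcal N$ put $m_0=\sum_k v_k$, $m_1=\sum_k k v_k$; for a time-dependent $v(t)$ write $m_0(t),m_1(t)$. General frozen percolation equation on $[0,T]$: given $v(0)\in\mathcal N^*$, a continuous $\lambda:[0,\infty)\to[0,\infty)$ and a control function $\Phi$ with $0\le\Phi(0)\le\Phi(s)\le\Phi(t)<m_0(0)$ for $0\le s\le t\le T$, a family $v(t)\in\mathcal N$, $t\in[0,T]$, solves it if for every $k\ge1$ and $t\in[0,T]$ $v_k(t)=v_k(0)+\int_0^t\Big(\tfrac k2\sum_{l=1}^{k-1}v_l(s)v_{k-l}(s)-k v_k(s)\big((m_0(0)-\Phi(s))+\lambda(s)\big)\Big)ds$ and $\theta(t):=m_0(0)-m_0(t)-\Phi(t)\ge0$ for all $t$. The subcritical equations are the general equation with $\lambda(t)\ge\lambda_{\inf}>0$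 and $\Phi(t)=m_0(0)-m_0(t)$; i.e. $v_k(t)=v_k(0)+\int_0^t\big(\tfrac k2\sum_{l=1}^{k-1}v_lv_{k-l}-k v_k m_0(s)-\lambda(s)k v_k\big)ds$. The critical equations are the same with $\lambda\equiv0$: $v_k(t)=v_k(0)+\int_0^t\big(\tfrac k2\sum_{l=1}^{k-1}v_lv_{k-l}-k v_k m_0(s)\big)ds$. A solution on $[0,\infty)$ means a solution on every $[0,T]$. Alternating equations: given burning times $0=\beta_0<\beta_1<\dots$ without accumulation points and $M(t):=\max\{i:\beta_i<t\}$, $v(t)\in\mathcal N$ solves them if for all $k$, $\dot v_k(t)=\tfrac k2\sum_{l=1}^{k-1}v_l(t)v_{k-l}(t)-k v_k(t)\,m_0(\beta_{M(t)})$ (in integrated form, $v_k$ continuous). *)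

theory Defs
  imports "HOL-Analysis.Analysis"
begin

text \<open>Sequences v = (v_k)_{k>=1} are represented as functions nat => real;
  only the indices k >= 1 are meaningful (index 0 is ignored).\<close>

definition in_N :: "(nat \<Rightarrow> real) \<Rightarrow> bool" where
  "in_N x \<longleftrightarrow> (\<forall>k\<ge>1. 0 \<le> x k) \<and> summable (\<lambda>k. x (Suc k))"

definition in_Nstar :: "(nat \<Rightarrow> real) \<Rightarrow> bool" where
  "in_Nstar x \<longleftrightarrow> in_N x \<and> finite {k. 1 \<le> k \<and> x k \<noteq> 0}"

definition m0 :: "(nat \<Rightarrow> real) \<Rightarrow> real" where
  "m0 x = (\<Sum>k. x (Suc k))"

definition coag :: "(nat \<Rightarrow> real) \<Rightarrow> nat \<Rightarrow> real" where
  "coag x k = real k / 2 * (\<Sum>l\<in>{1..k-1}. x l * x (k - l))"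

definition subcrit_sol :: "(nat \<Rightarrow> real) \<Rightarrow> (real \<Rightarrow> real) \<Rightarrow> (real \<Rightarrow> nat \<Rightarrow> real) \<Rightarrow> bool" where
  "subcrit_sol v0 lam v \<longleftrightarrow>
     (\<forall>t\<ge>0. in_N (v t) \<and>
        (\<forall>k\<ge>1. ((\<lambda>s. coag (v s) k - real k * v s k * m0 (v s) - lam s * real k * v s k)
                  has_integral (v t k - v0 k)) {0..t}))"

definition crit_sol :: "(nat \<Rightarrow> real) \<Rightarrow> (real \<Rightarrow> nat \<Rightarrow> real) \<Rightarrow> bool" where
  "crit_sol v0 v \<longleftrightarrow>
     (\<forall>t\<ge>0. in_N (v t) \<and>
        (\<forall>k\<ge>1. ((\<lambda>s. coag (v s) k - real k * v s k * m0 (v s))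
                  has_integral (v t k - v0 k)) {0..t}))"

definition Midx :: "(nat \<Rightarrow> real) \<Rightarrow> real \<Rightarrow> nat" where
  "Midx \<beta> t = Max {i. \<beta> i < t}"

definition alt_sol :: "(nat \<Rightarrow> real) \<Rightarrow> (nat \<Rightarrow> real) \<Rightarrow> (real \<Rightarrow> nat \<Rightarrow> real) \<Rightarrow> bool" where
  "alt_sol v0 \<beta> v \<longleftrightarrow>
     (\<forall>t\<ge>0. in_N (v t) \<and>
        (\<forall>k\<ge>1. ((\<lambda>s. coag (v s) k - real k * v s k * m0 (v (\<beta> (Midx \<beta> s))))
                  has_integral (v t k - v0 k)) {0..t}))"

definition unique_sol :: "((real \<Rightarrow> nat \<Rightarrow> real) \<Rightarrow> bool) \<Rightarrow> bool" where
  "unique_sol P \<longleftrightarrow> (\<exists>v. P v \<and> (\<forall>w. P w \<longrightarrow> (\<forall>t\<ge>0. \<forall>k\<ge>1. w t k = v t k)))"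

end

theory Submission
  imports Defs
begin

text \<open>
  If \<open>g\<close> denotes the factor of \<open>- k v\<^sub>k\<close> in any of the equations and \<open>G\<close> its integral, then
  \<open>v\<^sub>k(t) = exp (- k G(t)) p\<^sub>k(t)\<close>, where \<open>p\<close> solves \<open>p\<^sub>k' = coag p k\<close> and does not depend on \<open>g\<close>. With
  \<open>F(t,x) = (\<Sum>k. exp (- k x) p\<^sub>k(t))\<close> the subcritical and critical equations become the scalar equation
  \<open>G' = F(t,G) + \<lambda>\<close>. As \<open>F\<close> decreases in \<open>x\<close>, its solution is unique.

  For existence let \<open>U(x) = F(0,x)\<close>. The characteristics of Burgers' equation give \<open>F(t, x + t U(x)) = U(x)\<close>
  as long as \<open>- t U'(x) \<le> 1\<close>; this is mass conservation before gelation. Hence one looks for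
  \<open>G(t) = y(t) + t U(y(t))\<close> with \<open>G' = U(y) + \<lambda>\<close>. In the critical case \<open>y(t)\<close> minimises \<open>x + t U(x)\<close> over
  \<open>x \<ge> 0\<close>; in the subcritical case \<open>y' (1 + t U'(y)) = \<lambda>\<close>, which is solved for the inverse function of \<open>y\<close>.
  Between two burning times the alternating equations have a constant rate, which equals the mass at
  the last burning time.
\<close>

section \<open>Truncated sums and the coagulation term\<close>

definition part :: "(nat \<Rightarrow> real) \<Rightarrow> nat \<Rightarrow> real" where
  "part x K = (\<Sum>k=1..K. x k)"

lemma part_0 [simp]: "part x 0 = 0"
  by (simp add: part_def)

lemma part_Suc [simp]: "part x (Suc K) = part x K + x (Suc K)"
  by (simp add: part_def)

lemma part_conv_lessThan: "part x K = (\<Sum>k<K. x (Suc k))"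
  by (induction K) auto

lemma part_mono:
  assumes "\<And>k. k \<ge> 1 \<Longrightarrow> 0 \<le> x k" and "K \<le> L"
  shows "part x K \<le> part x L"
  unfolding part_def using assms by (intro sum_mono2) auto

lemma part_nonneg: "(\<And>k. k \<ge> 1 \<Longrightarrow> 0 \<le> x k) \<Longrightarrow> 0 \<le> part x K"
  unfolding part_def by (intro sum_nonneg) auto

lemma part_tendsto_m0: "in_N x \<Longrightarrow> part x \<longlonglongrightarrow> m0 x"
  unfolding in_N_def m0_def part_conv_lessThan by (blast intro: summable_LIMSEQ)

lemma part_le_m0: "in_N x \<Longrightarrow> part x K \<le> m0 x"
  unfolding in_N_def m0_def part_conv_lessThan by (intro sum_le_suminf) auto

lemma m0_le:
  assumes "in_N x" "\<And>K. part x K \<le> c"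
  shows "m0 x \<le> c"
  by (rule LIMSEQ_le_const2[OF part_tendsto_m0]) (use assms in auto)

lemma in_NI_bounded:
  assumes "\<And>k. k \<ge> 1 \<Longrightarrow> 0 \<le> x k" "\<And>K. part x K \<le> c"
  shows "in_N x"
  unfolding in_N_def
proof
  show "summable (\<lambda>k. x (Suc k))"
    by (rule summableI_nonneg_bounded[of _ c]) (use assms in \<open>auto simp: part_conv_lessThan\<close>)
qed (use assms in auto)

lemma m0_cong: "(\<And>k. k \<ge> 1 \<Longrightarrow> x k = y k) \<Longrightarrow> m0 x = m0 y"
  by (simp add: m0_def)

lemma coag_cong: "(\<And>l. 1 \<le> l \<Longrightarrow> l < k \<Longrightarrow> x l = y l) \<Longrightarrow> coag x k = coag y k"
  unfolding coag_def by (cases k) (auto intro!: sum.cong)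

lemma coag_nonneg: "(\<And>l. 1 \<le> l \<Longrightarrow> l < k \<Longrightarrow> 0 \<le> x l) \<Longrightarrow> 0 \<le> coag x k"
  unfolding coag_def by (intro mult_nonneg_nonneg sum_nonneg) auto

text \<open>Because l + (k - l) = k, the weights of the two factors multiply to a common one. Hence
  an integrating factor can remove the loss term without disturbing the gain term.\<close>

lemma coag_exp: "coag (\<lambda>l. exp (- real l * c) * x l) k = exp (- real k * c) * coag x k"
proof -
  have "exp (- real l * c) * x l * (exp (- real (k - l) * c) * x (k - l))
      = exp (- real k * c) * (x l * x (k - l))" if "l \<in> {1..k-1}" for l
  proof -
    have "exp (- real l * c) * exp (- real (k - l) * c) = exp (- real k * c)"
      unfolding exp_add[symmetric] using that
      by (subst of_nat_diff) (auto simp: algebra_simps)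
    then show ?thesis
      by (metis mult.assoc mult.left_commute)
  qed
  then have "(\<Sum>l=1..k-1. exp (- real l * c) * x l * (exp (- real (k - l) * c) * x (k - l)))
      = exp (- real k * c) * (\<Sum>l=1..k-1. x l * x (k - l))"
    unfolding sum_distrib_left by (intro sum.cong) auto
  then show ?thesis
    unfolding coag_def by (simp only: mult.left_commute)
qed

text \<open>The reflection l -> k - l averages the weights l and k - l to k / 2.\<close>

lemma coag_conv_weighted: "coag x k = (\<Sum>l=1..k-1. real l * x l * x (k - l))"
proof -
  have refl: "(\<Sum>l=1..k-1. real l * x l * x (k - l)) = (\<Sum>l=1..k-1. real (k - l) * x l * x (k - l))"
    by (rule sum.reindex_bij_witness[of _ "\<lambda>l. k - l" "\<lambda>l. k - l"]) auto
  have "2 * (\<Sum>l=1..k-1. real l * x l * x (k - l)) 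
      = (\<Sum>l=1..k-1. real l * x l * x (k - l)) + (\<Sum>l=1..k-1. real (k - l) * x l * x (k - l))"
    using refl by simp
  also have "\<dots> = (\<Sum>l=1..k-1. real k * (x l * x (k - l)))"
    unfolding sum.distrib[symmetric]
    by (intro sum.cong) (auto simp: of_nat_diff algebra_simps)
  also have "\<dots> = 2 * coag x k"
    unfolding coag_def sum_distrib_left[symmetric] by simp
  finally show ?thesis by linarith
qed

lemma part_coag: "part (coag x) K = (\<Sum>l=1..K. real l * x l * part x (K - l))"
proof (induction K)
  case (Suc K)
  have "(\<Sum>l=1..K. real l * x l * part x (Suc K - l)) 
      = (\<Sum>l=1..K. real l * x l * part x (K - l) + real l * x l * x (Suc K - l))"
    by (intro sum.cong) (auto simp: Suc_diff_le algebra_simps)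
  then show ?case
    using Suc by (simp add: sum.distrib coag_conv_weighted)
qed simp

text \<open>The point is the sign: for nonnegative \<open>x\<close>, a truncated mass cannot grow
  while the rate \<open>c\<close> dominates all shorter truncations.\<close>

lemma part_rhs: "part (\<lambda>k. coag x k - real k * x k * c) K
    = - (\<Sum>l=1..K. real l * x l * (c - part x (K - l)))"
proof -
  have "part (\<lambda>k. coag x k - real k * x k * c) K = part (coag x) K - (\<Sum>l=1..K. real l * x l * c)"
    by (simp add: part_def sum_subtractf)
  then show ?thesis
    by (simp add: part_coag right_diff_distrib sum_subtractf)
qed

text \<open>For a given rate, every solution is \<open>exp (- k G(t))\<close> times this solution of
  \<open>p\<^sub>k' = coag p k\<close>, where \<open>G\<close> is the integral of the rate.\<close>

function flory :: "(nat \<Rightarrow> real) \<Rightarrow> nat \<Rightarrow> real \<Rightarrow> real" where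
  "flory q k t = q k + integral {0..t} (\<lambda>s. real k / 2 * (\<Sum>l\<in>{1..k-1}. flory q l s * flory q (k - l) s))"
  by auto
termination by (relation "Wellfounded.measure (\<lambda>(q, k, t). k)") auto

declare flory.simps [simp del]

lemma flory_rec: "flory q k t = q k + integral {0..t} (\<lambda>s. coag (\<lambda>l. flory q l s) k)"
  by (subst flory.simps) (simp add: coag_def)

lemma flory_0 [simp]: "flory q k 0 = q k"
  by (subst flory_rec) simp

lemma continuous_on_coag:
  assumes "\<And>l. 1 \<le> l \<Longrightarrow> l < k \<Longrightarrow> continuous_on S (\<lambda>t. x t l)"
  shows "continuous_on S (\<lambda>t. coag (x t) k)"
  unfolding coag_def using assms by (intro continuous_intros) auto

lemma flory_has_derivative:
  assumes "0 \<le> t"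
  shows "(flory q k has_real_derivative coag (\<lambda>l. flory q l t) k) (at t within {0..})"
  using assms
proof (induction k arbitrary: t rule: less_induct)
  case (less k)
  have "continuous_on {0..} (flory q l)" if "l < k" for l
    using less.IH[OF that] by (intro DERIV_continuous_on) auto
  then have c: "continuous_on {0..t+1} (\<lambda>s. coag (\<lambda>l. flory q l s) k)"
    by (intro continuous_on_subset[OF continuous_on_coag[of k "{0..}"]]) auto
  have "(flory q k has_real_derivative coag (\<lambda>l. flory q l t) k) (at t within {0..t+1})"
    unfolding flory_rec[of q k]
    by (rule derivative_eq_intros integral_has_real_derivative[OF c] | use less.prems in simp)+
  \<comment> \<open>The margin 1 keeps \<open>t\<close> away from the right end of the
    interval.\<close>
  moreover have "at t within {0..t+1} = at t within {0..}"
    by (rule at_within_nhd[of _ "{..<t+1}"]) auto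
  ultimately show ?case by simp
qed

lemma continuous_on_flory: "continuous_on {0..} (flory q k)"
  by (rule DERIV_continuous_on[OF flory_has_derivative]) auto

lemma flory_nonneg:
  assumes "\<And>k. k \<ge> 1 \<Longrightarrow> 0 \<le> q k" "0 \<le> t" "k \<ge> 1"
  shows "0 \<le> flory q k t"
  using assms(2,3)
proof (induction k arbitrary: t rule: less_induct)
  case (less k)
  have "0 \<le> integral {0..t} (\<lambda>s. coag (\<lambda>l. flory q l s) k)"
    by (intro integral_nonneg integrable_continuous_interval
        continuous_on_subset[OF continuous_on_coag[OF continuous_on_flory]] coag_nonneg less) auto
  with assms(1) less.prems show ?case
    by (simp add: flory_rec[of q k])
qed

section \<open>Constant total rate: mass conservation before gelation\<close>

text \<open>The integrating factor in reverse: any differentiable \<open>G\<close> turns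
  \<open>flory\<close> into a solution whose rate is its derivative. All existence proofs build on
  this.\<close>

lemma exp_flory_has_derivative:
  fixes q G g t
  defines "x \<equiv> \<lambda>s l. exp (- real l * G s) * flory q l s"
  assumes "(G has_real_derivative g) (at t within S)" "0 \<le> t" "S \<subseteq> {0..}"
  shows "((\<lambda>s. x s k) has_real_derivative coag (x t) k - real k * x t k * g) (at t within S)"
proof -
  have "(flory q k has_real_derivative coag (\<lambda>l. flory q l t) k) (at t within S)"
    using flory_has_derivative[OF assms(3)] assms(4) by (rule DERIV_subset)
  then show ?thesis
    unfolding x_def coag_exp
    by (auto intro!: derivative_eq_intros assms(2) simp: algebra_simps)
qed

text \<open>By \<open>coag_exp\<close> the gain equation is invariant under exponential weights, so
  shifting the argument of the generating function amounts to changing the initial data.\<close>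

lemma flory_exp: "flory (\<lambda>k. exp (- real k * c) * q k) k t = exp (- real k * c) * flory q k t"
proof (induction k arbitrary: t rule: less_induct)
  case (less k)
  have "coag (\<lambda>l. flory (\<lambda>k. exp (- real k * c) * q k) l s) k
      = coag (\<lambda>l. exp (- real l * c) * flory q l s) k" for s
    by (rule coag_cong) (use less in auto)
  then have "flory (\<lambda>k. exp (- real k * c) * q k) k t
      = exp (- real k * c) * q k + integral {0..t} (\<lambda>s. exp (- real k * c) * coag (\<lambda>l. flory q l s) k)"
    by (subst flory_rec) (simp only: coag_exp)
  also have "\<dots> = exp (- real k * c) * flory q k t"
    by (subst (2) flory_rec) (simp add: distrib_left)
  finally show ?case .
qed

lemma flory_zero:
  assumes "\<And>k. k \<ge> 1 \<Longrightarrow> q k = 0" "k \<ge> 1"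
  shows "flory q k t = 0"
  using assms(2)
proof (induction k arbitrary: t rule: less_induct)
  case (less k)
  have "coag (\<lambda>l. flory q l s) k = coag (\<lambda>_. 0) k" for s
    by (rule coag_cong) (use less in auto)
  then show ?case
    by (subst flory_rec) (use assms(1) less.prems in \<open>simp add: coag_def\<close>)
qed

section \<open>First moments, convolutions and the flow at constant rate\<close>

definition wpart :: "(nat \<Rightarrow> real) \<Rightarrow> nat \<Rightarrow> real" where
  "wpart x K = (\<Sum>k=1..K. real k * x k)"

text \<open>Summation by parts: \<open>x k\<close> occurs in exactly the \<open>k\<close>
  differences with K < k.\<close>

lemma wpart_conv_part: "wpart x N = (\<Sum>K<N. part x N - part x K)"
proof (induction N)
  case (Suc N)
  then show ?case
    by (simp add: wpart_def sum.distrib sum_subtractf algebra_simps)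
qed (simp add: wpart_def)

text \<open>Putting j = K - l embeds the triangle of pairs (K, l) into a rectangle; the added terms
  are nonnegative.\<close>

lemma sum_convolution_le:
  fixes f d :: "nat \<Rightarrow> real"
  assumes "\<And>l. 0 \<le> f l" "\<And>l. 0 \<le> d l"
  shows "(\<Sum>K<n. \<Sum>l=1..K. f l * d (K - l)) \<le> (\<Sum>l=1..n. f l) * (\<Sum>j<n. d j)"
proof -
  have "(\<Sum>K<n. \<Sum>l=1..K. f l * d (K - l)) = (\<Sum>(K,l)\<in>Sigma {..<n} (\<lambda>K. {1..K}). f l * d (K - l))"
    by (rule sum.Sigma) auto
  also have "\<dots> \<le> (\<Sum>(l,j)\<in>{1..n} \<times> {..<n}. f l * d j)"
    by (rule sum_le_included[where i = "\<lambda>(l, j). (l + j, l)"]) 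
       (use assms in \<open>force+\<close>)
  also have "\<dots> = (\<Sum>l=1..n. f l) * (\<Sum>j<n. d j)"
    by (simp add: sum_product sum.cartesian_product)
  finally show ?thesis .
qed

text \<open>With c = \<open>m0 q\<close> this solution of constant rate describes both a
  characteristic before gelation and a period between burning times.\<close>

definition flow :: "(nat \<Rightarrow> real) \<Rightarrow> real \<Rightarrow> real \<Rightarrow> nat \<Rightarrow> real" where
  "flow q c t k = exp (- real k * (c * t)) * flory q k t"

lemma flow_0 [simp]: "flow q c 0 = q"
  by (rule ext) (simp add: flow_def)

lemma flow_nonneg:
  "(\<And>k. k \<ge> 1 \<Longrightarrow> 0 \<le> q k) \<Longrightarrow> 0 \<le> t \<Longrightarrow> k \<ge> 1 \<Longrightarrow> 0 \<le> flow q c t k"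
  by (simp add: flow_def flory_nonneg)

lemma flow_has_derivative_within:
  assumes "0 \<le> t"
  shows "((\<lambda>s. flow q c s k) has_real_derivative
           coag (flow q c t) k - real k * flow q c t k * c) (at t within {0..})"
  using exp_flory_has_derivative[of "\<lambda>t. c * t" c t "{0..}" k q] assms
  unfolding flow_def[abs_def] by (auto intro!: derivative_eq_intros)

lemma flow_has_derivative:
  assumes "0 < t"
  shows "((\<lambda>s. flow q c s k) has_real_derivative
           coag (flow q c t) k - real k * flow q c t k * c) (at t)"
proof -
  have "at t within {0..} = at t"
    using assms by (intro at_within_interior) auto
  with flow_has_derivative_within[of t q c k] assms show ?thesis by simp
qed

lemma continuous_on_flow: "continuous_on {0..} (\<lambda>s. flow q c s k)"
  by (rule DERIV_continuous_on[OF flow_has_derivative_within]) auto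

lemma part_flow_has_derivative:
  assumes "0 < t"
  shows "((\<lambda>s. c - part (flow q c s) K) has_real_derivative
           (\<Sum>l=1..K. real l * flow q c t l * (c - part (flow q c t) (K - l)))) (at t)"
proof -
  have "((\<lambda>s. part (flow q c s) K) has_real_derivative
      part (\<lambda>k. coag (flow q c t) k - real k * flow q c t k * c) K) (at t)"
    unfolding part_def by (rule DERIV_sum) (rule flow_has_derivative[OF assms])
  then show ?thesis
    unfolding part_rhs by (auto intro!: derivative_eq_intros)
qed

lemma continuous_on_part_flow: "continuous_on {0..} (\<lambda>s. part (flow q c s) K)"
  unfolding part_def by (intro continuous_intros continuous_on_flow)

text \<open>The derivative of the deficit of order \<open>K\<close> is a nonnegative combination of
  deficits of smaller order, so strong induction applies.\<close>

lemma part_flow_le: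
  assumes nonneg: "\<And>k. k \<ge> 1 \<Longrightarrow> 0 \<le> q k" and le: "\<And>K. part q K \<le> c" and "0 \<le> t"
  shows "part (flow q c t) K \<le> c"
  using \<open>0 \<le> t\<close>
proof (induction K arbitrary: t rule: less_induct)
  case (less K)
  have "c - part (flow q c 0) K \<le> c - part (flow q c t) K"
  proof (rule DERIV_nonneg_imp_increasing_open[OF less.prems])
    fix s assume s: "0 < s" "s < t"
    have "0 \<le> (\<Sum>l=1..K. real l * flow q c s l * (c - part (flow q c s) (K - l)))"
      using s less.IH[of _ s] by (intro sum_nonneg mult_nonneg_nonneg flow_nonneg nonneg) auto
    with part_flow_has_derivative[OF s(1)]
    show "\<exists>y. ((\<lambda>s. c - part (flow q c s) K) has_real_derivative y) (at s) \<and> 0 \<le> y" by blast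
  qed (intro continuous_intros continuous_on_subset[OF continuous_on_part_flow], auto)
  with le[of K] show ?case by simp
qed

text \<open>The tail-sum formula for the first moment: N tends to infinity in
  \<open>wpart_conv_part\<close>.\<close>

lemma sum_m0_minus_part_le:
  assumes "in_N q" and A: "\<And>N. wpart q N \<le> A"
  shows "(\<Sum>K<n. m0 q - part q K) \<le> A"
proof (rule LIMSEQ_le_const2)
  show "(\<lambda>N. \<Sum>K<n. part q N - part q K) \<longlonglongrightarrow> (\<Sum>K<n. m0 q - part q K)"
    by (intro tendsto_intros part_tendsto_m0 assms)
  have "(\<Sum>K<n. part q N - part q K) \<le> A" if "n \<le> N" for N
  proof -
    have "(\<Sum>K<n. part q N - part q K) \<le> (\<Sum>K<N. part q N - part q K)"
      using that assms(1) unfolding in_N_def by (intro sum_mono2) (auto intro!: part_mono)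
    with A[of N] show ?thesis by (simp add: wpart_conv_part)
  qed
  then show "\<exists>N. \<forall>n'\<ge>N. (\<Sum>K<n. part q n' - part q K) \<le> A" by blast
qed

text \<open>The cumulated deficit \<open>E n = (\<Sum>K<n. c - part w K)\<close> bounds
  the first moment of \<open>w\<close>, whence \<open>E' \<le> E\<^sup>2\<close>.\<close>

lemma m0_flow_eq:
  assumes q: "in_N q" and A: "\<And>N. wpart q N \<le> A" "0 < A" and t: "0 \<le> t" "t * A < 1"
  shows "m0 (flow q (m0 q) t) = m0 q"
proof (cases "m0 q = 0")
  \<comment> \<open>Treated apart because the main argument divides by \<open>E n\<close>, which is
    bounded below by \<open>m0 q\<close>.\<close>
  case True
  have "q k = 0" if k: "k \<ge> 1" for k
  proof -
    obtain j where j: "k = Suc j" using k by (cases k) auto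
    have "part q k \<le> 0" using part_le_m0[OF q, of k] True by simp
    moreover have "0 \<le> part q j" using q unfolding in_N_def by (intro part_nonneg) auto
    moreover have "0 \<le> q k" using q k unfolding in_N_def by auto
    ultimately show ?thesis using j by simp
  qed
  then show ?thesis
    by (simp add: m0_def flow_def flory_zero)
next
  case False
  define c where "c = m0 q"
  have qn: "0 \<le> q k" if "k \<ge> 1" for k using q that unfolding in_N_def by auto
  have ple: "part q K \<le> c" for K unfolding c_def by (rule part_le_m0[OF q])
  have "c > 0" using False ple[of 0] unfolding c_def by simp
  define D where "D = (\<lambda>s K. c - part (flow q c s) K)"
  define E where "E = (\<lambda>n s. \<Sum>K<n. D s K)"
  have D0: "0 \<le> D s K" if "0 \<le> s" for s K
    unfolding D_def using part_flow_le[OF qn ple that] by simp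
  have Dmono: "D s L \<le> D s K" if "0 \<le> s" "K \<le> L" for s K L
    unfolding D_def using part_mono[OF flow_nonneg[OF qn that(1)] that(2)] by simp
  have Epos: "c \<le> E n s" if "0 \<le> s" "n \<ge> 1" for n s
  proof -
    have "D s 0 \<le> E n s"
      unfolding E_def using that D0 by (intro member_le_sum) auto
    then show ?thesis by (simp add: D_def)
  qed
  \<comment> \<open>The bound solves e' = e^2 with e(0) = \<open>A\<close> and is finite before time
    1 / A. The comparison rests on the monotonicity of \<open>1 / E n s + s\<close>.\<close>
  have Ebound: "E n t \<le> 1 / (1 / A - t)" if n: "n \<ge> 1" for n
  proof -
    have "1 / E n 0 + 0 \<le> 1 / E n t + t"
    proof (rule DERIV_nonneg_imp_increasing_open[OF t(1)])
      fix s assume s: "0 < s" "s < t"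
      define E' where "E' = (\<Sum>K<n. \<Sum>l=1..K. real l * flow q c s l * D s (K - l))"
      have dE: "(E n has_real_derivative E') (at s)"
        unfolding E_def D_def E'_def by (intro DERIV_sum part_flow_has_derivative s)
      have fn: "0 \<le> real l * flow q c s l" for l
        using flow_nonneg[of q s l c] qn s by (cases l) auto
      \<comment> \<open>The first factor, a truncated first moment, is in turn at most
        \<open>E n s\<close>, because truncated masses do not exceed \<open>c\<close>.\<close>
      have "E' \<le> wpart (flow q c s) n * E n s"
        unfolding E'_def E_def wpart_def
        by (rule sum_convolution_le) (use fn D0 s in auto)
      also have "\<dots> \<le> E n s * E n s"
      proof (rule mult_right_mono)
        show "wpart (flow q c s) n \<le> E n s"
          unfolding wpart_conv_part E_def D_def
          using part_flow_le[OF qn ple, where t = s and K = n] s by (intro sum_mono) auto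
        show "0 \<le> E n s" unfolding E_def using D0 s by (intro sum_nonneg) auto
      qed
      finally have "E' \<le> E n s * E n s" .
      moreover have "0 < E n s" using Epos[of s n] s n \<open>c > 0\<close> by simp
      ultimately have "0 \<le> - (E' / (E n s * E n s)) + 1" by (simp add: divide_simps)
      moreover have "((\<lambda>s. 1 / E n s + s) has_real_derivative - (E' / (E n s * E n s)) + 1) (at s)"
        using \<open>0 < E n s\<close> by (auto intro!: derivative_eq_intros dE)
      ultimately show "\<exists>y. ((\<lambda>s. 1 / E n s + s) has_real_derivative y) (at s) \<and> 0 \<le> y" by blast
    next
      have "E n s \<noteq> 0" if "0 \<le> s" for s using Epos[OF that n] \<open>c > 0\<close> by simp
      then show "continuous_on {0..t} (\<lambda>s. 1 / E n s + s)"
        unfolding E_def D_def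
        by (intro continuous_intros continuous_on_subset[OF continuous_on_part_flow]) auto
    qed
    moreover have "E n 0 \<le> A"
      unfolding E_def D_def c_def using sum_m0_minus_part_le[OF q A(1)] by simp
    then have "1 / A \<le> 1 / E n 0"
      using Epos[of 0 n] n \<open>c > 0\<close> by (intro divide_left_mono) auto
    ultimately have "1 / A - t \<le> 1 / E n t" by simp
    moreover have "0 < 1 / A - t" using A t by (simp add: field_simps)
    moreover have "0 < E n t" using Epos[of t n] t n \<open>c > 0\<close> by simp
    ultimately show ?thesis by (simp add: field_simps)
  qed
  \<comment> \<open>As \<open>D t K\<close> decreases in \<open>K\<close>, \<open>n * D t n\<close>
    is at most \<open>E n t\<close>, which is bounded uniformly in \<open>n\<close>: no mass escapes
    to infinity.\<close>
  have "D t \<longlonglongrightarrow> 0"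
  proof (rule tendsto_sandwich)
    show "\<forall>\<^sub>F n in sequentially. 0 \<le> D t n" using D0[OF t(1)] by simp
    show "\<forall>\<^sub>F n in sequentially. D t n \<le> 1 / (1 / A - t) / real n"
      using eventually_ge_at_top[of 1]
    proof eventually_elim
      case (elim n)
      have "real n * D t n \<le> E n t"
        unfolding E_def using sum_mono[of "{..<n}" "\<lambda>_. D t n" "D t"] Dmono[OF t(1)] by auto
      with Ebound[OF elim] have "D t n * real n \<le> 1 / (1 / A - t)" by (simp add: mult.commute)
      then show ?case using elim by (subst pos_le_divide_eq) auto
    qed
    show "(\<lambda>n. 1 / (1 / A - t) / real n) \<longlonglongrightarrow> 0" by (rule lim_const_over_n)
  qed simp
  then have "(\<lambda>K. c - D t K) \<longlonglongrightarrow> c - 0" by (intro tendsto_intros)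
  then have "part (flow q c t) \<longlonglongrightarrow> c" by (simp add: D_def)
  moreover have "in_N (flow q c t)"
    using in_NI_bounded[OF flow_nonneg[OF qn t(1)] part_flow_le[OF qn ple t(1)]] by blast
  ultimately show ?thesis
    using LIMSEQ_unique part_tendsto_m0 unfolding c_def by blast
qed

section \<open>Solutions in terms of their cumulated rate\<close>

lemma eq_if_right_derivative_zero:
  fixes f :: "real \<Rightarrow> real"
  assumes "a \<le> b" and cont: "continuous_on {a..b} f"
    and deriv: "\<And>x. a \<le> x \<Longrightarrow> x < b \<Longrightarrow> (f has_real_derivative 0) (at x within {x..b})"
  shows "f b = f a"
proof -
  have bound: "\<bar>f b - f a\<bar> \<le> e * (b - a)" if e: "e > 0" for e
  proof (rule ccontr)
    assume neg: "\<not> ?thesis"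
    define T where "T = {x \<in> {a..b}. e * (x - a) < \<bar>f x - f a\<bar>}"
    have bT: "b \<in> T" using neg \<open>a \<le> b\<close> by (simp add: T_def)
    define s where "s = Inf T"
    have bdd: "bdd_below T" unfolding T_def by (intro bdd_belowI[of _ a]) auto
    have s_le: "s \<le> x" if "x \<in> T" for x unfolding s_def using bdd that by (rule cInf_lower[rotated])
    have s: "a \<le> s" "s \<le> b"
      using bT s_le unfolding s_def T_def by (auto intro!: cInf_greatest)
    have below: "\<bar>f x - f a\<bar> \<le> e * (x - a)" if "a \<le> x" "x < s" for x
      using s_le[of x] that s unfolding T_def by force
    have fs: "\<bar>f s - f a\<bar> \<le> e * (s - a)"
    proof (cases "s = a")
      case False
      have clo: "closure {a<..<s} = {a..s}" using False s by (simp add: closure_greaterThanLessThan)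
      have "0 \<le> e * (s - a) - \<bar>f s - f a\<bar>"
      proof (rule continuous_ge_on_closure[where S = "{a<..<s}" and x = s and f = "\<lambda>x. e * (x - a) - \<bar>f x - f a\<bar>"])
        show "continuous_on (closure {a<..<s}) (\<lambda>x. e * (x - a) - \<bar>f x - f a\<bar>)"
          unfolding clo using s by (intro continuous_intros continuous_on_subset[OF cont]) auto
        show "s \<in> closure {a<..<s}" unfolding clo using s by simp
        show "0 \<le> e * (x - a) - \<bar>f x - f a\<bar>" if "x \<in> {a<..<s}" for x
          using below[of x] that by simp
      qed
      then show ?thesis by simp
    qed simp
    then have "s \<notin> T" by (simp add: T_def)
    with bT s have "s < b" by (cases "s = b") auto
    with deriv[OF s(1)] have "((\<lambda>y. (f y - f s) / (y - s)) \<longlongrightarrow> 0) (at s within {s..b})"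
      by (simp add: has_field_derivative_iff)
    then obtain d where d: "d > 0"
      "\<And>y. y \<in> {s..b} \<Longrightarrow> y \<noteq> s \<Longrightarrow> \<bar>y - s\<bar> < d \<Longrightarrow> \<bar>(f y - f s) / (y - s)\<bar> < e"
      using e unfolding tendsto_iff eventually_at dist_real_def by auto
    have "s + d \<le> Inf T"
    proof (rule cInf_greatest)
      fix y assume y: "y \<in> T"
      show "s + d \<le> y"
      proof (rule ccontr)
        assume "\<not> ?thesis"
        moreover have "s < y" using s_le[OF y] y \<open>s \<notin> T\<close> by (cases "s = y") auto
        ultimately have "\<bar>(f y - f s) / (y - s)\<bar> < e"
          using d(2)[of y] y by (auto simp: T_def)
        then have "\<bar>f y - f s\<bar> < e * (y - s)" using \<open>s < y\<close> by (simp add: field_simps)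
        then have "\<bar>f y - f a\<bar> \<le> e * (y - a)" using fs by (simp add: algebra_simps)
        with y show False by (simp add: T_def)
      qed
    qed (use bT in auto)
    with d(1) show False by (simp add: s_def)
  qed
  show ?thesis
  proof (rule ccontr)
    assume "f b \<noteq> f a"
    then have "0 < \<bar>f b - f a\<bar>" by simp
    moreover from this have "a < b" using \<open>a \<le> b\<close> by (cases "a = b") auto
    ultimately show False
      using bound[of "\<bar>f b - f a\<bar> / (2 * (b - a))"] by (simp add: field_simps)
  qed
qed

lemma has_integral_subinterval:
  fixes f F :: "real \<Rightarrow> real"
  assumes f: "\<And>t. t \<in> {a..b} \<Longrightarrow> (f has_integral (F t - F a)) {a..t}"
    and "a \<le> s" "s \<le> t" "t \<le> b"
  shows "(f has_integral (F t - F s)) {s..t}"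
proof -
  have at: "f integrable_on {a..t}" using f[of t] assms(2-4) by auto
  have "integral {a..s} f + integral {s..t} f = integral {a..t} f"
    using at assms(2-4) by (intro Henstock_Kurzweil_Integration.integral_combine) auto
  moreover have "integral {a..s} f = F s - F a" "integral {a..t} f = F t - F a"
    using f[of s] f[of t] assms(2-4) by (auto simp: integral_unique)
  moreover have "f integrable_on {s..t}"
    using at assms(2-4) by (auto intro: integrable_subinterval_real)
  ultimately show ?thesis
    by (simp add: has_integral_iff)
qed

lemma continuous_on_has_integral:
  fixes f F :: "real \<Rightarrow> real"
  assumes f: "\<And>t. t \<in> {a..b} \<Longrightarrow> (f has_integral (F t - F a)) {a..t}"
  shows "continuous_on {a..b} F"
proof (cases "a \<le> b")
  case True
  have "continuous_on {a..b} (\<lambda>s. F a + integral {a..s} f)"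
    using f[of b] True by (intro continuous_intros indefinite_integral_continuous_1) auto
  moreover have "F a + integral {a..s} f = F s" if "s \<in> {a..b}" for s
    using f[OF that] by (simp add: integral_unique)
  ultimately show ?thesis by (rule continuous_on_eq)
qed auto

text \<open>The rate \<open>g\<close> of a solution is only known to be right-continuous at first, so derivatives are
  taken from the right.\<close>

lemma solution_eq_flory:
  fixes w :: "real \<Rightarrow> nat \<Rightarrow> real"
  assumes w: "\<And>t k. t \<in> {a..b} \<Longrightarrow> k \<ge> 1 \<Longrightarrow>
      ((\<lambda>s. coag (w s) k - real k * w s k * g s) has_integral (w t k - w a k)) {a..t}"
    and contG: "continuous_on {a..b} G" and "G a = 0"
    and derG: "\<And>t. a \<le> t \<Longrightarrow> t < b \<Longrightarrow> (G has_real_derivative g t) (at t within {t..b})"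
    and contg: "\<And>t. a \<le> t \<Longrightarrow> t < b \<Longrightarrow> continuous (at t within {t..b}) g"
    and "t \<in> {a..b}" "k \<ge> 1"
  shows "w t k = exp (- real k * G t) * flory (w a) k (t - a)"
  using assms(6,7)
proof (induction k arbitrary: t rule: less_induct)
  case (less k)
  let ?f = "\<lambda>k s. coag (w s) k - real k * w s k * g s"
  have wint: "((?f k) has_integral (w t k - w s k)) {s..t}" 
    if "a \<le> s" "s \<le> t" "t \<le> b" "k \<ge> 1" for s t k
    by (rule has_integral_subinterval[of a b _ "\<lambda>s. w s k"]) (use w that in auto)
  have cont: "continuous_on {a..b} (\<lambda>s. w s k)" if "k \<ge> 1" for k
    by (rule continuous_on_has_integral) (use w that in auto)
  have derw: "((\<lambda>s. w s k) has_real_derivative ?f k x) (at x within {x..b})" 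
    if "a \<le> x" "x < b" for x
  proof -
    have "continuous (at x within {x..b} - {}) (?f k)"
    proof -
      have "continuous (at x within {x..b}) (\<lambda>s. w s l)" if "l \<ge> 1" for l
        using cont[OF that] \<open>a \<le> x\<close> \<open>x < b\<close>
        by (intro continuous_within_subset[of x "{a..b}" _ "{x..b}"])
           (auto simp: continuous_on_eq_continuous_within)
      moreover from this have "continuous (at x within {x..b}) (\<lambda>s. coag (w s) k)"
        unfolding coag_def by (intro continuous_intros) auto
      ultimately show ?thesis
        using contg[OF that] less.prems by (auto intro!: continuous_intros)
    qed
    then have "((\<lambda>u. integral {x..u} (?f k)) has_vector_derivative ?f k x) (at x within ({x..b} - {}))"
      using wint[of x b k] that less.prems
      by (intro integral_has_vector_derivative_continuous_at) auto
    then have "((\<lambda>u. w x k + integral {x..u} (?f k)) has_real_derivative ?f k x) (at x within {x..b})"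
      by (auto simp: has_real_derivative_iff_has_vector_derivative intro!: derivative_eq_intros)
    then show ?thesis
    proof (rule has_field_derivative_transform_within[where d = 1])
      show "w x k + integral {x..s} (?f k) = w s k" if "s \<in> {x..b}" for s
        using wint[of x s k] that \<open>a \<le> x\<close> less.prems by (auto simp: integral_unique)
    qed (use that in auto)
  qed
  define q where "q = w a"
  \<comment> \<open>Without the integrating factor both terms have the same right derivative: the
    gain terms involve only indices below \<open>k\<close>, where the induction hypothesis
    applies.\<close>
  define f where "f = (\<lambda>s. exp (real k * G s) * w s k - flory q k (s - a))"
  have shift: "((\<lambda>s. flory q k (s - a)) has_real_derivative coag (\<lambda>l. flory q l (x - a)) k) (at x within {x..b})"
    if "a \<le> x" for x
  proof -
    have "(flory q k \<circ> (\<lambda>s. s - a) has_real_derivative coag (\<lambda>l. flory q l (x - a)) k * 1) (at x within {x..b})"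
      using that by (intro DERIV_image_chain DERIV_subset[OF flory_has_derivative])
                    (auto intro!: derivative_eq_intros)
    then show ?thesis by (simp add: o_def)
  qed
  have "f t = f a"
  proof (rule eq_if_right_derivative_zero[where f = f and a = a and b = t])
    have "continuous_on {a..t} (\<lambda>s. flory q k (s - a))"
      by (rule continuous_on_compose2[OF continuous_on_flory]) (auto intro!: continuous_intros)
    then show "continuous_on {a..t} f"
      unfolding f_def using less.prems
      by (intro continuous_intros continuous_on_subset[OF contG] continuous_on_subset[OF cont]) auto
    fix x assume x: "a \<le> x" "x < t"
    then have xb: "x < b" using less.prems by auto
    have "coag (w x) k = coag (\<lambda>l. exp (- real l * G x) * flory q l (x - a)) k"
      by (rule coag_cong) (use less.IH x xb in \<open>auto simp: q_def\<close>)
    then have "coag (w x) k = exp (- real k * G x) * coag (\<lambda>l. flory q l (x - a)) k"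
      by (simp only: coag_exp)
    then have c: "exp (real k * G x) * coag (w x) k = coag (\<lambda>l. flory q l (x - a)) k"
      by (simp add: exp_minus)
    have "(f has_real_derivative 0) (at x within {x..b})"
      unfolding f_def
      by (rule derivative_eq_intros derw derG shift x xb refl)+ 
         (simp add: algebra_simps c[symmetric])
    then show "(f has_real_derivative 0) (at x within {x..t})"
      by (rule DERIV_subset) (use less.prems in auto)
  qed (use less.prems in auto)
  then have "exp (real k * G t) * w t k = flory q k (t - a)"
    using \<open>G a = 0\<close> by (simp add: f_def q_def)
  then show ?case
    by (simp add: q_def exp_minus field_simps)
qed

section \<open>Uniqueness for the subcritical and critical equations\<close>

lemma flory_cong:
  assumes "\<And>k. k \<ge> 1 \<Longrightarrow> q k = r k" "k \<ge> 1"
  shows "flory q k t = flory r k t"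
  using assms(2)
proof (induction k arbitrary: t rule: less_induct)
  case (less k)
  have "coag (\<lambda>l. flory q l s) k = coag (\<lambda>l. flory r l s) k" for s
    by (rule coag_cong) (use less in auto)
  then show ?case
    using assms(1)[OF less.prems] by (simp only: flory_rec[of q k] flory_rec[of r k])
qed

section \<open>Regularity of the total mass of a solution\<close>

lemma subcrit_sol_integral:
  assumes "subcrit_sol v0 lam w" "k \<ge> 1" "0 \<le> s" "s \<le> t"
  shows "((\<lambda>s. coag (w s) k - real k * w s k * (m0 (w s) + lam s)) has_integral (w t k - w s k)) {s..t}"
proof -
  have I: "((\<lambda>s. coag (w s) k - real k * w s k * (m0 (w s) + lam s)) has_integral (w t k - v0 k)) {0..t}"
    if "0 \<le> t" for t
    using assms(1,2) that unfolding subcrit_sol_def by (auto simp: algebra_simps)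
  have "w 0 k = v0 k" using has_integral_unique[OF I[of 0], of 0] by (simp add: has_integral_refl)
  with I have I0: "((\<lambda>s. coag (w s) k - real k * w s k * (m0 (w s) + lam s)) has_integral (w t k - w 0 k)) {0..t}"
    if "0 \<le> t" for t using that by auto
  show ?thesis
    by (rule has_integral_subinterval[of 0 t _ "\<lambda>s. w s k"]) (use I0 assms(3,4) in auto)
qed

lemma subcrit_sol_initial:
  assumes "subcrit_sol v0 lam w" "k \<ge> 1"
  shows "w 0 k = v0 k"
proof -
  have "((\<lambda>s. coag (w s) k - real k * w s k * m0 (w s) - lam s * real k * w s k) has_integral (w 0 k - v0 k)) {0..0}"
    using assms unfolding subcrit_sol_def by auto
  from has_integral_unique[OF this, of 0] show ?thesis by (simp add: has_integral_refl)
qed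

text \<open>The rate \<open>m0 + lam\<close> dominates every truncated mass, so by
  \<open>part_rhs\<close> no truncation grows. Integrability and right continuity of the total mass,
  which the definition of a solution does not state, are derived from this.\<close>

lemma subcrit_sol_m0_antimono:
  assumes sol: "subcrit_sol v0 lam w" and lam: "\<And>t. 0 \<le> t \<Longrightarrow> 0 \<le> lam t" and st: "0 \<le> s" "s \<le> t"
  shows "m0 (w t) \<le> m0 (w s)"
proof (rule m0_le)
  have N: "in_N (w r)" if "0 \<le> r" for r using sol that unfolding subcrit_sol_def by auto
  then show "in_N (w t)" using st by auto
  fix K
  have "((\<lambda>s. part (\<lambda>k. coag (w s) k - real k * w s k * (m0 (w s) + lam s)) K) 
      has_integral (\<Sum>k=1..K. w t k - w s k)) {s..t}"
    unfolding part_def by (intro has_integral_sum subcrit_sol_integral[OF sol] st) auto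
  then have "(\<Sum>k=1..K. w t k - w s k) \<le> 0"
  proof (rule has_integral_le[OF _ has_integral_0])
    fix r assume r: "r \<in> {s..t}"
    have "0 \<le> (\<Sum>l=1..K. real l * w r l * (m0 (w r) + lam r - part (w r) (K - l)))"
      using N[of r] r st lam[of r] part_le_m0[of "w r"] unfolding in_N_def
      by (intro sum_nonneg mult_nonneg_nonneg) (auto simp: add_increasing2 le_diff_eq)
    then show "part (\<lambda>k. coag (w r) k - real k * w r k * (m0 (w r) + lam r)) K \<le> 0"
      unfolding part_rhs by simp
  qed
  then have "part (w t) K \<le> part (w s) K" by (simp add: part_def sum_subtractf)
  also have "\<dots> \<le> m0 (w s)" using N st part_le_m0 by blast
  finally show "part (w t) K \<le> m0 (w s)" .
qed

text \<open>The total mass is a supremum of continuous truncations, hence lower semicontinuous; for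
  a decreasing function that gives right continuity.\<close>

lemma subcrit_sol_right_continuous:
  assumes sol: "subcrit_sol v0 lam w" and lam: "\<And>t. 0 \<le> t \<Longrightarrow> 0 \<le> lam t" and t: "0 \<le> t"
  shows "continuous (at t within {t..b}) (\<lambda>s. m0 (w s))"
  unfolding continuous_within
proof (rule tendstoI)
  fix e :: real assume e: "e > 0"
  have N: "in_N (w r)" if "0 \<le> r" for r using sol that unfolding subcrit_sol_def by auto
  have "\<forall>\<^sub>F K in sequentially. m0 (w t) - e < part (w t) K"
    using part_tendsto_m0[OF N[OF t]] e by (intro order_tendstoD) auto
  then obtain K where K: "m0 (w t) - e < part (w t) K"
    by (auto dest: eventually_happens)
  have "continuous_on {t..b} (\<lambda>s. w s k)" if "k \<ge> 1" for k
    by (rule continuous_on_has_integral[OF subcrit_sol_integral[OF sol that]]) (use t in auto)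
  then have c: "continuous_on {t..b} (\<lambda>s. part (w s) K)"
    unfolding part_def by (intro continuous_intros) auto
  show "\<forall>\<^sub>F s in at t within {t..b}. dist (m0 (w s)) (m0 (w t)) < e"
  proof (cases "t \<le> b")
    case True
    with c have "((\<lambda>s. part (w s) K) \<longlongrightarrow> part (w t) K) (at t within {t..b})"
      by (auto simp: continuous_on_def)
    then have "\<forall>\<^sub>F s in at t within {t..b}. m0 (w t) - e < part (w s) K"
      using K by (rule order_tendstoD)
    moreover have "\<forall>\<^sub>F s in at t within {t..b}. s \<in> {t..b}"
      by (simp add: eventually_at_filter)
    ultimately show ?thesis
    proof eventually_elim
      case (elim s)
      have "m0 (w s) \<le> m0 (w t)" using elim t by (intro subcrit_sol_m0_antimono[OF sol lam]) auto
      moreover have "part (w s) K \<le> m0 (w s)" using elim t N by (intro part_le_m0) auto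
      ultimately show ?case using elim(1) by (simp add: dist_real_def)
    qed
  qed auto
qed

section \<open>The cumulated rate determines the solution\<close>

definition cumrate :: "(real \<Rightarrow> real) \<Rightarrow> (real \<Rightarrow> nat \<Rightarrow> real) \<Rightarrow> real \<Rightarrow> real" where
  "cumrate lam w t = integral {0..t} (\<lambda>s. m0 (w s) + lam s)"

lemma subcrit_sol_rate_integrable:
  assumes sol: "subcrit_sol v0 lam w" and lam: "\<And>t. 0 \<le> t \<Longrightarrow> 0 \<le> lam t" 
    and contlam: "continuous_on {0..} lam" and "0 \<le> a"
  shows "(\<lambda>s. m0 (w s) + lam s) integrable_on {a..b}"
proof -
  have "mono_on {a..b} (\<lambda>s. - m0 (w s))"
    using subcrit_sol_m0_antimono[OF sol lam] \<open>0 \<le> a\<close> by (auto simp: monotone_on_def)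
  from integrable_neg[OF integrable_on_mono_on[OF this]] 
  have "(\<lambda>s. m0 (w s)) integrable_on {a..b}" by simp
  moreover have "lam integrable_on {a..b}"
    using \<open>0 \<le> a\<close> by (intro integrable_continuous_interval continuous_on_subset[OF contlam]) auto
  ultimately show ?thesis by (rule integrable_add)
qed

lemma cumrate_diff:
  assumes sol: "subcrit_sol v0 lam w" and lam: "\<And>t. 0 \<le> t \<Longrightarrow> 0 \<le> lam t" 
    and contlam: "continuous_on {0..} lam" and "0 \<le> s" "s \<le> t"
  shows "cumrate lam w t = cumrate lam w s + integral {s..t} (\<lambda>s. m0 (w s) + lam s)"
  unfolding cumrate_def
  by (rule Henstock_Kurzweil_Integration.integral_combine[OF assms(4,5), symmetric],
      rule subcrit_sol_rate_integrable[OF sol lam contlam]) auto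

lemma continuous_on_cumrate:
  assumes sol: "subcrit_sol v0 lam w" and lam: "\<And>t. 0 \<le> t \<Longrightarrow> 0 \<le> lam t" 
    and contlam: "continuous_on {0..} lam"
  shows "continuous_on {0..b} (cumrate lam w)"
  unfolding cumrate_def
  by (rule indefinite_integral_continuous_1[OF subcrit_sol_rate_integrable[OF sol lam contlam]]) auto

lemma subcrit_sol_eq_flory:
  assumes sol: "subcrit_sol v0 lam w" and lam: "\<And>t. 0 \<le> t \<Longrightarrow> 0 \<le> lam t" 
    and contlam: "continuous_on {0..} lam" and "0 \<le> t" "k \<ge> 1"
  shows "w t k = exp (- real k * cumrate lam w t) * flory v0 k t"
proof -
  let ?g = "\<lambda>s. m0 (w s) + lam s"
  have contg: "continuous (at s within {s..t}) ?g" if "0 \<le> s" "s < t" for s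
  proof (rule continuous_add)
    have "continuous (at s within {0..}) lam"
      using contlam that by (simp add: continuous_on_eq_continuous_within)
    then show "continuous (at s within {s..t}) lam"
      using that by (intro continuous_within_subset[of s "{0..}" _ "{s..t}"]) auto
  qed (rule subcrit_sol_right_continuous[OF sol lam that(1)])
  have "w t k = exp (- real k * cumrate lam w t) * flory (w 0) k (t - 0)"
  proof (rule solution_eq_flory[where g = ?g and b = t])
    show "((\<lambda>s. coag (w s) k - real k * w s k * ?g s) has_integral (w u k - w 0 k)) {0..u}"
      if "u \<in> {0..t}" "k \<ge> 1" for u k
      using that by (intro subcrit_sol_integral[OF sol]) auto
    show "continuous_on {0..t} (cumrate lam w)" by (rule continuous_on_cumrate[OF sol lam contlam])
    show "cumrate lam w 0 = 0" by (simp add: cumrate_def)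
    fix s assume s: "0 \<le> s" "s < t"
    show "continuous (at s within {s..t}) ?g" by (rule contg[OF s])
    have "((\<lambda>u. integral {s..u} ?g) has_vector_derivative ?g s) (at s within ({s..t} - {}))"
      using s contg[OF s]
      by (intro integral_has_vector_derivative_continuous_at subcrit_sol_rate_integrable[OF sol lam contlam]) auto
    then have "((\<lambda>u. cumrate lam w s + integral {s..u} ?g) has_real_derivative ?g s) (at s within {s..t})"
      by (auto simp: has_real_derivative_iff_has_vector_derivative intro!: derivative_eq_intros)
    then show "(cumrate lam w has_real_derivative ?g s) (at s within {s..t})"
    proof (rule has_field_derivative_transform_within[where d = 1])
      show "cumrate lam w s + integral {s..u} ?g = cumrate lam w u" if "u \<in> {s..t}" for u
        by (rule cumrate_diff[OF sol lam contlam, symmetric]) (use s that in auto)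
    qed (use s in auto)
  qed (use assms in auto)
  also have "flory (w 0) k (t - 0) = flory v0 k t"
    using subcrit_sol_initial[OF sol] \<open>k \<ge> 1\<close> by (simp add: flory_cong[of "w 0" v0])
  finally show ?thesis .
qed

text \<open>The total mass of the solution is a decreasing function of the cumulated rate, so the larger of
  two cumulated rates grows more slowly.\<close>

lemma cumrate_le:
  assumes u: "subcrit_sol v0 lam u" and w: "subcrit_sol v0 lam w"
    and lam: "\<And>t. 0 \<le> t \<Longrightarrow> 0 \<le> lam t" and contlam: "continuous_on {0..} lam"
    and v0: "\<And>k. k \<ge> 1 \<Longrightarrow> 0 \<le> v0 k" and t: "0 \<le> t"
  shows "cumrate lam u t \<le> cumrate lam w t"
proof (rule ccontr)
  define d where "d = (\<lambda>s. cumrate lam u s - cumrate lam w s)"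
  assume "\<not> ?thesis"
  then have dt: "0 < d t" by (simp add: d_def)
  have contd: "continuous_on {0..t} d"
    unfolding d_def
    by (intro continuous_intros continuous_on_cumrate[OF u lam contlam] continuous_on_cumrate[OF w lam contlam])
  \<comment> \<open>Let \<open>s\<close> be the last zero of \<open>d\<close> before
    \<open>t\<close>. On [s, t] \<open>d\<close> is nonnegative, so \<open>u\<close> has the smaller
    mass there and \<open>d\<close> cannot have grown.\<close>
  define Z where "Z = {s \<in> {0..t}. d s = 0}"
  have "closed Z"
    unfolding Z_def by (rule continuous_closed_preimage_constant[OF contd]) simp
  moreover have "bounded Z"
    by (rule bounded_subset[of "{0..t}"]) (auto simp: Z_def)
  ultimately have "compact Z" by (simp add: compact_eq_bounded_closed)
  moreover have "0 \<in> Z" using t by (simp add: Z_def d_def cumrate_def)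
  ultimately obtain s where s: "s \<in> Z" "\<And>r. r \<in> Z \<Longrightarrow> r \<le> s"
    using compact_attains_sup[of Z] by blast
  then have st: "0 \<le> s" "s \<le> t" "d s = 0" by (auto simp: Z_def)
  have pos: "0 \<le> d r" if r: "r \<in> {s..t}" for r
  proof (rule ccontr)
    assume neg: "\<not> ?thesis"
    have "\<exists>x\<ge>r. x \<le> t \<and> d x = 0"
      using neg dt r st by (intro IVT' continuous_on_subset[OF contd]) auto
    then obtain x where x: "r \<le> x" "x \<le> t" "d x = 0" by blast
    then have "x \<in> Z" using r st by (simp add: Z_def)
    from s(2)[OF this] x r have "r = s" by auto
    with neg st show False by simp
  qed
  have "m0 (u r) \<le> m0 (w r)" if r: "r \<in> {s..t}" for r
  proof (rule m0_le)
    have r0: "0 \<le> r" using r st by auto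
    then show "in_N (u r)" using u unfolding subcrit_sol_def by auto
    fix K
    have "part (u r) K \<le> part (w r) K"
      unfolding part_def
    proof (rule sum_mono)
      fix k assume k: "k \<in> {1..K}"
      have "exp (- real k * cumrate lam u r) \<le> exp (- real k * cumrate lam w r)"
        using pos[OF r] by (simp add: d_def mult_left_mono)
      then show "u r k \<le> w r k"
        using k r0 flory_nonneg[of v0 r k] v0
        by (simp add: subcrit_sol_eq_flory[OF u lam contlam] subcrit_sol_eq_flory[OF w lam contlam] mult_right_mono)
    qed
    also have "\<dots> \<le> m0 (w r)" using w r0 unfolding subcrit_sol_def by (intro part_le_m0) auto
    finally show "part (u r) K \<le> m0 (w r)" .
  qed
  then have "integral {s..t} (\<lambda>s. m0 (u s) + lam s) \<le> integral {s..t} (\<lambda>s. m0 (w s) + lam s)"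
    using st by (intro integral_le subcrit_sol_rate_integrable[OF u lam contlam] 
        subcrit_sol_rate_integrable[OF w lam contlam]) auto
  then have "d t \<le> d s"
    unfolding d_def using cumrate_diff[OF u lam contlam st(1,2)] cumrate_diff[OF w lam contlam st(1,2)] by simp
  with dt st show False by simp
qed

lemma subcrit_sol_unique:
  assumes u: "subcrit_sol v0 lam u" and w: "subcrit_sol v0 lam w"
    and lam: "\<And>t. 0 \<le> t \<Longrightarrow> 0 \<le> lam t" and contlam: "continuous_on {0..} lam"
    and v0: "\<And>k. k \<ge> 1 \<Longrightarrow> 0 \<le> v0 k" and "0 \<le> t" "k \<ge> 1"
  shows "u t k = w t k"
proof -
  have "cumrate lam u t = cumrate lam w t"
    using cumrate_le[OF u w lam contlam v0 \<open>0 \<le> t\<close>] cumrate_le[OF w u lam contlam v0 \<open>0 \<le> t\<close>] by simp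
  then show ?thesis
    using assms by (simp add: subcrit_sol_eq_flory[OF u lam contlam] subcrit_sol_eq_flory[OF w lam contlam])
qed

section \<open>Characteristics\<close>

locale finite_initial =
  fixes q :: "nat \<Rightarrow> real" and N :: nat
  assumes nonneg: "\<And>k. k \<ge> 1 \<Longrightarrow> 0 \<le> q k" and vanish: "\<And>k. N < k \<Longrightarrow> q k = 0"
begin

text \<open>The generating function of the initial data in the variable exp (- x). Below,
  \<open>- a\<close> is its derivative, \<open>- b\<close> that of \<open>a\<close>, and
  \<open>a 0\<close> is the initial first moment.\<close>

definition U :: "real \<Rightarrow> real" where
  "U x = (\<Sum>k=1..N. exp (- real k * x) * q k)"

definition a :: "real \<Rightarrow> real" where
  "a x = (\<Sum>k=1..N. real k * (exp (- real k * x) * q k))"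

definition b :: "real \<Rightarrow> real" where
  "b x = (\<Sum>k=1..N. real k * (real k * (exp (- real k * x) * q k)))"

lemma U_nonneg: "0 \<le> U x" and a_nonneg: "0 \<le> a x" and b_nonneg: "0 \<le> b x"
  unfolding U_def a_def b_def by (auto intro!: sum_nonneg mult_nonneg_nonneg nonneg)

lemma U_has_derivative: "(U has_real_derivative - a x) (at x within S)"
  unfolding U_def[abs_def] a_def by (auto intro!: derivative_eq_intros simp: sum_negf mult_ac)

lemma a_has_derivative: "(a has_real_derivative - b x) (at x within S)"
  unfolding a_def[abs_def] b_def by (auto intro!: derivative_eq_intros simp: sum_negf mult_ac)

lemma continuous_on_U: "continuous_on S U"
  by (rule DERIV_continuous_on[OF U_has_derivative])

lemma continuous_on_a: "continuous_on S a"
  by (rule DERIV_continuous_on[OF a_has_derivative])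

text \<open>All exponents \<open>k\<close> are at least 1, so \<open>a\<close> decays at least like
  exp (- x). Besides monotonicity this gives the growth of \<open>1 / a\<close> used in the critical
  case.\<close>

lemma a_exp_le:
  assumes "x \<le> y"
  shows "a y \<le> exp (x - y) * a x"
  unfolding a_def sum_distrib_left
proof (rule sum_mono)
  fix k assume k: "k \<in> {1..N}"
  have "1 * (y - x) \<le> real k * (y - x)"
    using k assms by (intro mult_right_mono) auto
  then have "exp (- real k * y) \<le> exp (x - y) * exp (- real k * x)"
    unfolding exp_add[symmetric] by (simp add: algebra_simps)
  then have "real k * exp (- real k * y) * q k \<le> real k * (exp (x - y) * exp (- real k * x)) * q k"
    using k nonneg[of k] by (intro mult_right_mono mult_left_mono) auto
  then show "real k * (exp (- real k * y) * q k) \<le> exp (x - y) * (real k * (exp (- real k * x) * q k))"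
    by (simp add: mult_ac)
qed

lemma a_antimono: "x \<le> y \<Longrightarrow> a y \<le> a x"
  using a_exp_le[of x y] mult_right_mono[of "exp (x - y)" 1 "a x"] a_nonneg[of x] by simp

lemma a_strict_antimono:
  assumes "x < y" "0 < a x"
  shows "a y < a x"
proof -
  have "a y \<le> exp (x - y) * a x" using assms by (intro a_exp_le) auto
  also have "\<dots> < 1 * a x" using assms by (intro mult_strict_right_mono) auto
  finally show ?thesis by simp
qed

text \<open>Convexity of \<open>U\<close>, from 1 + z <= exp z in each summand.\<close>

lemma U_tangent: "U y - a y * (x - y) \<le> U x"
proof -
  have "U y - a y * (x - y) = (\<Sum>k=1..N. (exp (- real k * y) * (1 - real k * (x - y))) * q k)"
    unfolding U_def a_def sum_distrib_right sum_subtractf[symmetric]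
    by (intro sum.cong) (auto simp: algebra_simps)
  also have "\<dots> \<le> U x"
    unfolding U_def
  proof (intro sum_mono mult_right_mono nonneg)
    fix k assume "k \<in> {1..N}"
    have "exp (- real k * y) * (1 - real k * (x - y)) \<le> exp (- real k * y) * exp (- real k * (x - y))"
      using exp_ge_add_one_self[of "- real k * (x - y)"] by (intro mult_left_mono) auto
    also have "\<dots> = exp (- real k * x)"
      unfolding exp_add[symmetric] by (simp add: algebra_simps)
    finally show "exp (- real k * y) * (1 - real k * (x - y)) \<le> exp (- real k * x)" .
  qed auto
  finally show ?thesis .
qed

text \<open>Tilting moves the base point of the generating function from 0 to \<open>x\<close>: the
  mass becomes \<open>U x\<close>, and \<open>a x\<close> bounds the truncated first
  moments.\<close>

definition tilt :: "real \<Rightarrow> nat \<Rightarrow> real" where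
  "tilt x k = exp (- real k * x) * q k"

lemma tilt_nonneg: "k \<ge> 1 \<Longrightarrow> 0 \<le> tilt x k"
  by (simp add: tilt_def nonneg)

lemma part_tilt_le: "part (tilt x) K \<le> U x"
proof -
  have "part (tilt x) K \<le> part (tilt x) (max K N)"
    by (rule part_mono) (auto simp: tilt_nonneg)
  also have "\<dots> = part (tilt x) N"
    unfolding part_def by (intro sum.mono_neutral_right) (auto simp: tilt_def vanish)
  finally show ?thesis by (simp add: U_def part_def tilt_def)
qed

lemma wpart_tilt_le: "wpart (tilt x) K \<le> a x"
proof -
  have "wpart (tilt x) K \<le> wpart (tilt x) (max K N)"
    unfolding wpart_def by (intro sum_mono2 mult_nonneg_nonneg) (auto simp: tilt_nonneg)
  also have "\<dots> = wpart (tilt x) N"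
    unfolding wpart_def by (intro sum.mono_neutral_right) (auto simp: tilt_def vanish)
  finally show ?thesis by (simp add: a_def wpart_def tilt_def)
qed

lemma in_N_tilt: "in_N (tilt x)"
  by (rule in_NI_bounded[OF tilt_nonneg part_tilt_le])

lemma m0_tilt: "m0 (tilt x) = U x"
proof (rule antisym)
  show "m0 (tilt x) \<le> U x" by (rule m0_le[OF in_N_tilt part_tilt_le])
  show "U x \<le> m0 (tilt x)"
    using part_le_m0[OF in_N_tilt, of x N] by (simp add: U_def part_def tilt_def)
qed

text \<open>The tilt \<open>x\<close> and the cumulated rate \<open>t * U x\<close> add up to the
  position of the characteristic at time \<open>t\<close>. This turns mass conservation for tilted
  data into a statement on \<open>flory q\<close>.\<close>

lemma flow_tilt: "flow (tilt x) (U x) t = (\<lambda>k. exp (- real k * (x + t * U x)) * flory q k t)"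
proof
  fix k
  have "flory (tilt x) k t = exp (- real k * x) * flory q k t"
    unfolding tilt_def[abs_def] by (rule flory_exp)
  then show "flow (tilt x) (U x) t k = exp (- real k * (x + t * U x)) * flory q k t"
    by (simp add: flow_def exp_add[symmetric] algebra_simps)
qed

text \<open>In terms of the generating function \<open>F(t,x) = (\<Sum>k. exp (- k x) p\<^sub>k(t))\<close> this says that the
  characteristic of Burgers' equation issuing from \<open>x\<close> carries the value \<open>U x\<close> up to the time \<open>1 / a x\<close>.
  At that time itself it follows by continuity from the characteristics to the right.\<close>

lemma characteristic:
  fixes x t
  defines "w \<equiv> \<lambda>k. exp (- real k * (x + t * U x)) * flory q k t"
  assumes t: "0 \<le> t" and le: "t * a x \<le> 1"
  shows "in_N w" "m0 w = U x"
proof -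
  define W where "W = (\<lambda>x. flow (tilt x) (U x) t)"
  have w: "w = W x" unfolding w_def W_def flow_tilt ..
  have bound: "part (W x) K \<le> U x" for x K
    unfolding W_def by (rule part_flow_le[OF tilt_nonneg part_tilt_le t])
  have Wnonneg: "0 \<le> W x k" if "k \<ge> 1" for x k
    unfolding W_def by (rule flow_nonneg[OF tilt_nonneg t that])
  have N: "in_N (W x)" for x
    by (rule in_NI_bounded[OF Wnonneg bound])
  then show "in_N w" by (simp add: w)
  have strict: "m0 (W x) = U x" if lt: "t * a x < 1" for x
  proof -
    \<comment> \<open>Mass conservation asks for a positive bound; if \<open>a x\<close> vanishes, 1
      / (t + 1) is one with \<open>t * A < 1\<close>.\<close>
    define A where "A = (if a x = 0 then 1 / (t + 1) else a x)"
    have "a x \<le> A" using t by (simp add: A_def)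
    then have "wpart (tilt x) K \<le> A" for K
      using wpart_tilt_le[of x K] by simp
    moreover have "0 < A" using a_nonneg[of x] t by (auto simp: A_def)
    moreover have "t * A < 1" using lt t by (auto simp: A_def)
    ultimately show ?thesis
      using m0_flow_eq[OF in_N_tilt, of x A t] t by (simp add: m0_tilt W_def)
  qed
  show "m0 w = U x"
  proof (cases "t * a x < 1")
    case True
    then show ?thesis using strict w by simp
  next
    case False
    then have eq: "t * a x = 1" using le by simp
    then have "t > 0" "a x > 0" using t a_nonneg[of x] by (auto simp: less_le)
    have "U z \<le> m0 w" if z: "x < z" for z
    proof -
      have "a z < a x" by (rule a_strict_antimono[OF z \<open>a x > 0\<close>])
      with \<open>t > 0\<close> have "t * a z < t * a x" by simp
      then have "m0 (W z) = U z" using strict eq by simp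
      moreover have "m0 (W z) \<le> m0 w"
      proof (rule m0_le[OF N])
        \<comment> \<open>As \<open>t * a x = 1\<close>, the convex function z + t * U z is minimal
          at \<open>x\<close>. A characteristic from the right thus ends no further left, and its
          sequence lies below \<open>w\<close>.\<close>
        have "t * (U x - a x * (z - x)) \<le> t * U z"
          using U_tangent[of x z] \<open>t > 0\<close> by (intro mult_left_mono) auto
        then have "t * U x - (t * a x) * (z - x) \<le> t * U z" by (simp add: algebra_simps)
        then have sh: "x + t * U x \<le> z + t * U z" using eq by simp
        fix K
        have "part (W z) K \<le> part w K"
          unfolding part_def w_def W_def flow_tilt
        proof (intro sum_mono mult_right_mono flory_nonneg nonneg t)
          show "exp (- real k * (z + t * U z)) \<le> exp (- real k * (x + t * U x))" for k
            using mult_left_mono[OF sh, of "real k"] by simp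
        qed auto
        also have "\<dots> \<le> m0 w" using N w by (simp add: part_le_m0)
        finally show "part (W z) K \<le> m0 w" .
      qed
      ultimately show ?thesis by simp
    qed
    moreover have "(U \<longlongrightarrow> U x) (at_right x)"
      using continuous_on_U[of UNIV] by (auto simp: continuous_on_def intro: tendsto_within_subset)
    ultimately have "U x \<le> m0 w"
      by (intro tendsto_upperbound[where F = "at_right x" and f = U])
         (auto simp: eventually_at_filter)
    moreover have "m0 w \<le> U x" using m0_le[OF N bound] w by simp
    ultimately show ?thesis by simp
  qed
qed

text \<open>Reduction to a scalar problem: the characteristic from \<open>y t\<close> is at
  \<open>G t\<close> at time \<open>t\<close>, so the constructed sequence has mass
  \<open>U (y t)\<close>, and the equation for \<open>G\<close> is the required
  self-consistency.\<close>

lemma subcrit_solI: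
  assumes y: "\<And>t. 0 \<le> t \<Longrightarrow> t * a (y t) \<le> 1"
    and G: "\<And>t. 0 \<le> t \<Longrightarrow> G t = y t + t * U (y t)"
    and "y 0 = 0" and cont: "continuous_on {0..} G"
    and der: "\<And>t. 0 < t \<Longrightarrow> (G has_real_derivative (U (y t) + lam t)) (at t)"
  shows "subcrit_sol q lam (\<lambda>t k. exp (- real k * G t) * flory q k t)"
proof -
  define v where "v = (\<lambda>t k. exp (- real k * G t) * flory q k t)"
  have v: "in_N (v t)" "m0 (v t) = U (y t)" if "0 \<le> t" for t
    using characteristic[OF that y[OF that]] G[OF that] by (simp_all add: v_def)
  have "G 0 = 0" using G[of 0] \<open>y 0 = 0\<close> by simp
  have "((\<lambda>s. coag (v s) k - real k * v s k * m0 (v s) - lam s * real k * v s k)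
            has_integral (v t k - q k)) {0..t}" if "0 \<le> t" "k \<ge> 1" for t k
  proof -
    have "((\<lambda>s. coag (v s) k - real k * v s k * m0 (v s) - lam s * real k * v s k)
            has_integral (v t k - v 0 k)) {0..t}"
    proof (rule fundamental_theorem_of_calculus_interior[OF \<open>0 \<le> t\<close>])
      show "continuous_on {0..t} (\<lambda>s. v s k)"
        unfolding v_def
        by (intro continuous_intros continuous_on_subset[OF cont] continuous_on_subset[OF continuous_on_flory]) auto
      fix s assume s: "s \<in> {0<..<t}"
      then have "at s within {0..} = at s" by (intro at_within_interior) auto
      with s exp_flory_has_derivative[of G "U (y s) + lam s" s "{0..}" k q] der[of s] v(2)[of s]
      show "((\<lambda>s. v s k) has_vector_derivative
          coag (v s) k - real k * v s k * m0 (v s) - lam s * real k * v s k) (at s)"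
        by (simp add: v_def has_real_derivative_iff_has_vector_derivative[symmetric] algebra_simps)
    qed
    then show ?thesis using \<open>G 0 = 0\<close> by (simp add: v_def)
  qed
  with v(1) show ?thesis
    unfolding subcrit_sol_def v_def[symmetric] by blast
qed

end

section \<open>Existence for the critical equations\<close>

lemma isCont_inv:
  fixes f :: "real \<Rightarrow> real"
  assumes "bij f" "continuous_on UNIV f"
  shows "isCont (inv f) t"
proof -
  have "isCont (inv f) (f (inv f t))"
  proof (rule isCont_inverse_function[where d = 1 and f = f and g = "inv f" and x = "inv f t"])
    show "inv f (f z) = z" for z using \<open>bij f\<close> by (simp add: bij_is_inj)
    show "isCont f z" for z using assms(2) by (simp add: continuous_on_eq_continuous_at)
  qed simp
  then show ?thesis using \<open>bij f\<close> by (simp add: bij_is_surj surj_f_inv_f)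
qed

context finite_initial
begin

lemma a_pos_if_a_0_pos:
  assumes "0 < a 0"
  shows "0 < a x"
proof -
  have "a x \<noteq> 0"
  proof
    assume "a x = 0"
    then have "\<forall>k\<in>{1..N}. q k = 0"
      unfolding a_def by (subst (asm) sum_nonneg_eq_0_iff) (auto intro!: mult_nonneg_nonneg nonneg)
    then have "a 0 = 0" unfolding a_def by simp
    with assms show False by simp
  qed
  with a_nonneg[of x] show ?thesis by simp
qed

text \<open>The characteristic starting from \<open>y t\<close> reaches \<open>0\<close> at time \<open>t\<close>. After gelation, when \<open>t * a (y t) = 1\<close>,
  this is the last moment at which that characteristic carries information.\<close>

lemma critical_start_point:
  obtains y where "continuous_on {0..} y" "y 0 = 0" "\<And>t. 0 \<le> t \<Longrightarrow> 0 \<le> y t"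
    "\<And>t. 0 \<le> t \<Longrightarrow> t * a (y t) \<le> 1" "\<And>t. 0 \<le> t \<Longrightarrow> t * a (y t) = 1 \<or> y t = 0"
proof (cases "a 0 = 0")
  case True
  show ?thesis by (rule that[of "\<lambda>_. 0"]) (use True in auto)
next
  case False
  then have a0: "0 < a 0" using a_nonneg[of 0] by simp
  note apos = a_pos_if_a_0_pos[OF a0]
  \<comment> \<open>For x >= 0 this is the time at which the characteristic from \<open>x\<close>
    expires. The extension with slope 1 makes \<open>r\<close> a bijection of the line; negative
    values of its inverse belong to times before gelation and are cut off at 0 in
    \<open>y\<close>.\<close>
  define r where "r = (\<lambda>x. 1 / a (max 0 x) + min 0 x)"
  have contr: "continuous_on UNIV r"
    unfolding r_def using apos
    by (intro continuous_intros continuous_on_compose2[OF continuous_on_a[of UNIV]]) (auto simp: less_imp_neq[symmetric])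
  have "strict_mono r"
  proof (rule strict_monoI)
    fix x z :: real assume xz: "x < z"
    have "1 / a (max 0 x) \<le> 1 / a (max 0 z)"
      using xz by (intro divide_left_mono a_antimono mult_pos_pos apos) auto
    moreover have "1 / a x < 1 / a z" if "0 \<le> x"
      using xz by (intro divide_strict_left_mono a_strict_antimono mult_pos_pos apos) auto
    ultimately show "r x < r z"
      using xz by (cases "0 \<le> x") (auto simp: r_def)
  qed
  moreover have "surj r"
  proof -
    have "\<exists>x. r x = t" for t
    proof -
      define lo where "lo = min 0 (t - 1 / a 0)"
      \<comment> \<open>This gives \<open>t * a hi <= 1\<close>, since
        \<open>exp hi * a hi <= a 0\<close> and \<open>t * a 0 <= 1 + hi <= exp hi\<close>.\<close>
      define hi where "hi = max 0 (t * a 0)"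
      have "r lo \<le> t" by (simp add: r_def lo_def)
      moreover have "t \<le> r hi"
      proof -
        have "a hi \<le> exp (- hi) * a 0" using a_exp_le[of 0 hi] by (simp add: hi_def)
        then have "exp hi * a hi \<le> exp hi * (exp (- hi) * a 0)" by (intro mult_left_mono) auto
        also have "\<dots> = a 0" by (simp add: exp_minus)
        finally have "exp hi * a hi \<le> a 0" .
        moreover have "(1 + hi) * a hi \<le> exp hi * a hi"
          using exp_ge_add_one_self[of hi] a_nonneg by (intro mult_right_mono) auto
        moreover have "t * a 0 * a hi \<le> (1 + hi) * a hi"
          using a_nonneg by (intro mult_right_mono) (auto simp: hi_def)
        ultimately have "t * a hi * a 0 \<le> 1 * a 0" by (simp add: mult_ac)
        then have "t * a hi \<le> 1" using a0 by (simp only: mult_le_cancel_right)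
        then show ?thesis using apos[of hi] by (simp add: r_def hi_def pos_le_divide_eq)
      qed
      moreover have "lo \<le> hi" by (simp add: lo_def hi_def)
      ultimately show ?thesis
        using IVT'[of r lo t hi] continuous_on_subset[OF contr] by blast
    qed
    then show ?thesis by (metis surjI)
  qed
  ultimately have bij: "bij r" by (simp add: bij_def strict_mono_imp_inj_on)
  define y where "y = (\<lambda>t. max 0 (inv r t))"
  have r: "t * a (y t) = 1 + min 0 (inv r t) * a (y t)" for t
  proof -
    have "t = 1 / a (y t) + min 0 (inv r t)"
      using surj_f_inv_f[OF \<open>surj r\<close>, of t] by (simp add: r_def y_def)
    then have "t * a (y t) = (1 / a (y t) + min 0 (inv r t)) * a (y t)" by simp
    then show ?thesis using apos[of "y t"] by (simp add: distrib_right)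
  qed
  show ?thesis
  proof
    show "continuous_on {0..} y"
      unfolding y_def using isCont_inv[OF bij contr]
      by (intro continuous_intros) (auto intro: continuous_at_imp_continuous_on)
    show "t * a (y t) \<le> 1" for t
      using r[of t] mult_nonpos_nonneg[of "min 0 (inv r t)" "a (y t)"] a_nonneg by simp
    show eq: "t * a (y t) = 1 \<or> y t = 0" for t
      using r[of t] by (auto simp: y_def)
    from eq[of 0] show "y 0 = 0" by simp
  qed (simp add: y_def)
qed

text \<open>An envelope argument: \<open>G t\<close> is the minimum of x + t * U x over x >= 0,
  attained at \<open>y t\<close>, so its derivative in \<open>t\<close> is \<open>U (y t)\<close>
  even where \<open>y\<close> is not differentiable.\<close>

lemma critical_existence: "\<exists>v. subcrit_sol q (\<lambda>_. 0) v"
proof -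
  obtain y where conty: "continuous_on {0..} y" and "y 0 = 0" and ynonneg: "\<And>t. 0 \<le> t \<Longrightarrow> 0 \<le> y t"
    and le: "\<And>t. 0 \<le> t \<Longrightarrow> t * a (y t) \<le> 1" and crit: "\<And>t. 0 \<le> t \<Longrightarrow> t * a (y t) = 1 \<or> y t = 0"
    by (rule critical_start_point) blast
  define G where "G = (\<lambda>t. y t + t * U (y t))"
  have contUy: "continuous_on {0..} (\<lambda>t. U (y t))"
    by (rule continuous_on_compose2[OF continuous_on_U conty]) auto
  \<comment> \<open>The properties of \<open>y s\<close> are the first-order conditions for a
    minimum on the half-line; by convexity they suffice.\<close>
  have min: "G s \<le> x + s * U x" if "0 \<le> s" "0 \<le> x" for s x
  proof -
    have "s * a (y s) * (x - y s) \<le> x - y s"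
      using crit[OF that(1)] le[OF that(1)] mult_right_mono[OF le[OF that(1)] that(2)] by auto
    moreover have "s * (U (y s) - a (y s) * (x - y s)) \<le> s * U x"
      using U_tangent that(1) by (intro mult_left_mono) auto
    ultimately show ?thesis by (simp add: G_def algebra_simps)
  qed
  \<comment> \<open>Used for (s, t) and (t, s), this encloses the difference quotient of
    \<open>G\<close> between \<open>U (y s)\<close> and \<open>U (y t)\<close>.\<close>
  have upper: "G s - G t \<le> (s - t) * U (y t)" if "0 \<le> s" "0 \<le> t" for s t
    using min[OF that(1) ynonneg[OF that(2)]] by (simp add: G_def algebra_simps)
  have der: "(G has_real_derivative U (y t)) (at t)" if t: "0 < t" for t
  proof -
    have "((\<lambda>s. U (y s)) \<longlongrightarrow> U (y t)) (at t)"
      using continuous_on_interior[OF contUy, of t] t by (simp add: continuous_at)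
    then have "((\<lambda>s. \<bar>U (y s) - U (y t)\<bar>) \<longlongrightarrow> 0) (at t)"
      by (simp add: LIM_zero tendsto_rabs_zero)
    moreover have "\<forall>\<^sub>F s in at t. norm ((G s - G t) / (s - t) - U (y t)) \<le> \<bar>U (y s) - U (y t)\<bar>"
    proof -
      have "\<forall>\<^sub>F s in at t. s \<in> {0<..}"
        using t by (intro eventually_at_in_open') auto
      moreover have "\<forall>\<^sub>F s in at t. s \<noteq> t" by (simp add: eventually_at_filter)
      ultimately show ?thesis
      proof eventually_elim
        case (elim s)
        have bounds: "G s - G t \<le> (s - t) * U (y t)" "(s - t) * U (y s) \<le> G s - G t"
          using upper[of s t] upper[of t s] elim t by (auto simp: algebra_simps)
        show ?case
        proof (cases "t < s")
          case True
          then have "(G s - G t) / (s - t) \<le> U (y t)" "U (y s) \<le> (G s - G t) / (s - t)"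
            using bounds by (auto simp: field_simps)
          then show ?thesis by simp
        next
          case False
          then have "s < t" using elim by simp
          then have "U (y t) \<le> (G s - G t) / (s - t)" "(G s - G t) / (s - t) \<le> U (y s)"
            using bounds by (auto simp: field_simps)
          then show ?thesis by simp
        qed
      qed
    qed
    ultimately have "((\<lambda>s. (G s - G t) / (s - t) - U (y t)) \<longlongrightarrow> 0) (at t)"
      by (rule Lim_null_comparison[rotated])
    then show ?thesis
      by (simp add: has_field_derivative_iff LIM_zero_iff)
  qed
  have "subcrit_sol q (\<lambda>_. 0) (\<lambda>t k. exp (- real k * G t) * flory q k t)"
  proof (rule subcrit_solI[where y = y])
    show "continuous_on {0..} G"
      unfolding G_def by (intro continuous_intros conty contUy)
  qed (use le der \<open>y 0 = 0\<close> in \<open>auto simp: G_def\<close>)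
  then show ?thesis by blast
qed

end

section \<open>Existence for the subcritical equations\<close>

text \<open>The factor 1 / c gained by integrating the weight yields the contraction below.\<close>

lemma exp_weighted_integral_le:
  fixes h :: "real \<Rightarrow> real"
  assumes "0 < c" "0 \<le> y" "0 \<le> B" "continuous_on {0..y} h"
    and "\<And>z. 0 \<le> z \<Longrightarrow> z \<le> y \<Longrightarrow> \<bar>h z\<bar> \<le> B * exp (c * z)"
  shows "\<bar>integral {0..y} h\<bar> \<le> B * exp (c * y) / c"
proof -
  have "((\<lambda>z. B * exp (c * z)) has_integral (B * exp (c * y) / c - B * exp (c * 0) / c)) {0..y}"
    by (rule fundamental_theorem_of_calculus)
       (use assms in \<open>auto intro!: derivative_eq_intros simp flip: has_real_derivative_iff_has_vector_derivative\<close>)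
  then have I: "(\<lambda>z. B * exp (c * z)) integrable_on {0..y}"
    "integral {0..y} (\<lambda>z. B * exp (c * z)) = B * exp (c * y) / c - B / c"
    by (auto simp: has_integral_iff)
  have "norm (integral {0..y} h) \<le> integral {0..y} (\<lambda>z. B * exp (c * z))"
    by (rule integral_norm_bound_integral[OF integrable_continuous_interval[OF assms(4)] I(1)])
       (use assms(5) in auto)
  moreover have "0 \<le> B / c" using assms by simp
  ultimately show ?thesis using I(2) by simp
qed

text \<open>A contraction in the norm weighted by \<open>exp (- c y)\<close>.\<close>

lemma volterra_solution:
  fixes L a :: "real \<Rightarrow> real"
  assumes lip: "\<And>x y. \<bar>L x - L y\<bar> \<le> D * \<bar>x - y\<bar>" and "L 0 = 0" and "0 < D"
    and conta: "continuous_on {0..} a" and a: "\<And>y. 0 \<le> y \<Longrightarrow> 0 \<le> a y" "\<And>y. 0 \<le> y \<Longrightarrow> a y \<le> A"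
  obtains th where "continuous_on {0..} th"
    "\<And>y. 0 \<le> y \<Longrightarrow> th y = L (y - integral {0..y} (\<lambda>z. th z * a z))"
proof -
  have "0 \<le> A" using a[of 0] by simp
  \<comment> \<open>Makes the contraction constant \<open>A * D / c\<close> at most 1 / 2.\<close>
  define c where "c = 2 * A * D + 1"
  have c: "0 < c" "A * D / c \<le> 1 / 2"
    using \<open>0 \<le> A\<close> \<open>0 < D\<close> by (auto simp: c_def field_simps add_pos_nonneg)
  have contL: "continuous_on S L" for S
  proof (rule lipschitz_on_continuous_on)
    show "D-lipschitz_on S L"
      using lip \<open>0 < D\<close> by (intro lipschitz_onI) (auto simp: dist_real_def)
  qed
  \<comment> \<open>The unknown is \<open>exp (c * z)\<close> times a bounded function
    \<open>u\<close>. In \<open>P\<close>, \<open>max 0\<close> extends the map to the whole line,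
    so that the complete space of bounded continuous functions on the reals can be used.\<close>
  define J where "J = (\<lambda>u y. integral {0..y} (\<lambda>z. exp (c * z) * apply_bcontfun u z * a z))"
  define P where "P = (\<lambda>u y. exp (- c * max 0 y) * L (max 0 y - J u (max 0 y)))"
  have conti: "continuous_on {0..y} (\<lambda>z. exp (c * z) * apply_bcontfun u z * a z)" for u y
    by (intro continuous_intros continuous_on_subset[OF conta]) auto
  have contJ: "continuous_on {0..} (J u)" for u
  proof -
    have "continuous_on {0..y} (J u)" for y
      unfolding J_def by (intro indefinite_integral_continuous_1 integrable_continuous_interval conti)
    then have "continuous (at x within {0..x+1}) (J u)" if "0 \<le> x" for x
      using that by (simp add: continuous_on_eq_continuous_within)
    moreover have "at x within {0..x+1} = at x within {0..}" for x :: real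
      by (rule at_within_nhd[of _ "{..<x+1}"]) auto
    ultimately show ?thesis
      by (simp add: continuous_on_eq_continuous_within continuous_within)
  qed
  have J_diff: "\<bar>J u y - J w y\<bar> \<le> A * dist u w * exp (c * y) / c" if "0 \<le> y" for u w y
  proof -
    have "J u y - J w y = integral {0..y} (\<lambda>z. exp (c * z) * apply_bcontfun u z * a z - exp (c * z) * apply_bcontfun w z * a z)"
      unfolding J_def by (intro Henstock_Kurzweil_Integration.integral_diff[symmetric] integrable_continuous_interval conti)
    also have "\<bar>\<dots>\<bar> \<le> A * dist u w * exp (c * y) / c"
    proof (rule exp_weighted_integral_le[OF c(1) that])
      fix z assume z: "0 \<le> z" "z \<le> y"
      have "\<bar>exp (c * z) * apply_bcontfun u z * a z - exp (c * z) * apply_bcontfun w z * a z\<bar>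
          = exp (c * z) * (dist (apply_bcontfun u z) (apply_bcontfun w z) * a z)"
        using a(1)[OF z(1)] by (simp add: dist_real_def abs_mult flip: left_diff_distrib right_diff_distrib)
      also have "\<dots> \<le> exp (c * z) * (dist u w * A)"
        using a[OF z(1)] by (intro mult_left_mono mult_mono dist_bounded) auto
      finally show "\<bar>exp (c * z) * apply_bcontfun u z * a z - exp (c * z) * apply_bcontfun w z * a z\<bar>
          \<le> A * dist u w * exp (c * z)" by (simp add: mult_ac)
    qed (use \<open>0 \<le> A\<close> in \<open>auto intro!: continuous_on_diff conti\<close>)
    finally show ?thesis .
  qed
  have P_diff: "\<bar>P u y - P w y\<bar> \<le> 1 / 2 * dist u w" for u w y
  proof -
    define y' where "y' = max 0 y"
    have y': "0 \<le> y'" by (simp add: y'_def)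
    have "\<bar>P u y - P w y\<bar> = exp (- c * y') * \<bar>L (y' - J u y') - L (y' - J w y')\<bar>"
      unfolding P_def y'_def[symmetric] by (simp add: abs_mult flip: right_diff_distrib)
    also have "\<dots> \<le> exp (- c * y') * (D * (A * dist u w * exp (c * y') / c))"
    proof (rule mult_left_mono)
      have "\<bar>L (y' - J u y') - L (y' - J w y')\<bar> \<le> D * \<bar>J u y' - J w y'\<bar>"
        using lip[of "y' - J u y'" "y' - J w y'"] by (simp add: abs_minus_commute)
      also have "\<dots> \<le> D * (A * dist u w * exp (c * y') / c)"
        using J_diff[OF y'] \<open>0 < D\<close> by (intro mult_left_mono) auto
      finally show "\<bar>L (y' - J u y') - L (y' - J w y')\<bar> \<le> D * (A * dist u w * exp (c * y') / c)" .
    qed simp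
    also have "\<dots> = A * D / c * dist u w" by (simp add: exp_minus field_simps)
    also have "\<dots> \<le> 1 / 2 * dist u w" using c(2) by (intro mult_right_mono) auto
    finally show ?thesis .
  qed
  have bcont: "P u \<in> bcontfun" for u
  proof (rule bcontfun_normI)
    have "continuous_on UNIV (\<lambda>y. J u (max 0 y))"
      by (rule continuous_on_compose2[OF contJ]) (auto intro!: continuous_intros)
    then show "continuous_on UNIV (P u)"
      unfolding P_def by (intro continuous_intros continuous_on_compose2[OF contL[of UNIV]]) auto
    fix y
    have "\<bar>P 0 y\<bar> \<le> D / c"
    proof -
      define y' where "y' = max 0 y"
      have "\<bar>P 0 y\<bar> = exp (- c * y') * \<bar>L y' - L 0\<bar>"
        unfolding P_def y'_def[symmetric] by (simp add: J_def abs_mult \<open>L 0 = 0\<close>)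
      also have "\<dots> \<le> exp (- c * y') * (D * y')"
        using lip[of y' 0] by (intro mult_left_mono) (auto simp: y'_def)
      also have "\<dots> \<le> exp (- c * y') * (D * (exp (c * y') / c))"
      proof (intro mult_left_mono)
        have "c * y' \<le> exp (c * y')" using exp_ge_add_one_self[of "c * y'"] by linarith
        then show "y' \<le> exp (c * y') / c" using c(1) by (simp add: field_simps)
      qed (use \<open>0 < D\<close> in auto)
      also have "\<dots> = D / c" by (simp add: exp_minus field_simps)
      finally show ?thesis .
    qed
    with P_diff[of u y 0] show "norm (P u y) \<le> D / c + 1 / 2 * dist u 0"
      unfolding real_norm_def by linarith
  qed
  define T where "T = (\<lambda>u. Bcontfun (P u))"
  have T: "apply_bcontfun (T u) = P u" for u
    unfolding T_def using bcont by (simp add: Bcontfun_inverse)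
  have "\<exists>!u. T u = u"
  proof (rule banach_fix_type)
    show "\<forall>u w. dist (T u) (T w) \<le> 1 / 2 * dist u w"
    proof (intro allI dist_bound)
      show "dist (apply_bcontfun (T u) y) (apply_bcontfun (T w) y) \<le> 1 / 2 * dist u w" for u w y
        unfolding T dist_real_def by (rule P_diff)
    qed
  qed auto
  then obtain u where "T u = u" by blast
  then have u: "apply_bcontfun u = P u" using T[of u] by simp
  define th where "th = (\<lambda>y. exp (c * y) * apply_bcontfun u y)"
  show ?thesis
  proof
    show "continuous_on {0..} th" unfolding th_def by (intro continuous_intros) auto
    fix y :: real assume y: "0 \<le> y"
    have "th y = exp (c * y) * P u y" by (simp add: th_def u)
    also have "\<dots> = L (y - J u y)"
      using y by (simp add: P_def max_def exp_minus)
    finally show "th y = L (y - integral {0..y} (\<lambda>z. th z * a z))"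
      by (simp add: J_def th_def)
  qed
qed

lemma pos_by_first_zero:
  fixes f :: "real \<Rightarrow> real"
  assumes cont: "continuous_on {0..} f" and "0 < f 0"
    and step: "\<And>s. 0 < s \<Longrightarrow> (\<And>x. 0 \<le> x \<Longrightarrow> x < s \<Longrightarrow> 0 < f x) \<Longrightarrow> 0 < f s"
    and y: "0 \<le> y"
  shows "0 < f y"
proof (rule ccontr)
  assume neg: "\<not> 0 < f y"
  define Z where "Z = {0..y} \<inter> f -` {..0}"
  have "closed Z"
    unfolding Z_def
    by (rule continuous_closed_preimage) (use continuous_on_subset[OF cont] in auto)
  moreover have "bounded Z"
    by (rule bounded_subset[of "{0..y}"]) (auto simp: Z_def)
  moreover have "y \<in> Z" using neg y by (simp add: Z_def)
  ultimately obtain s where s: "s \<in> Z" "\<And>x. x \<in> Z \<Longrightarrow> s \<le> x"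
    using compact_attains_inf[of Z] by (auto simp: compact_eq_bounded_closed)
  have "0 < f x" if "0 \<le> x" "x < s" for x
    using s(2)[of x] s(1) that by (force simp: Z_def)
  moreover have "0 < s" using s(1) \<open>0 < f 0\<close> by (cases "s = 0") (auto simp: Z_def)
  ultimately have "0 < f s" by (rule step[rotated])
  with s(1) show False by (simp add: Z_def)
qed

text \<open>\<open>L\<close> inverts the integral of \<open>lam\<close>; the lower bound
  \<open>l\<close> makes it Lipschitz. Its last property says that it tends to infinity.\<close>

lemma inverse_of_cumulated_rate:
  fixes lam :: "real \<Rightarrow> real"
  assumes cont: "continuous_on {0..} lam" and "0 < l" and l: "\<And>t. 0 \<le> t \<Longrightarrow> l \<le> lam t"
  obtains L where "L 0 = 0" "\<And>x y. \<bar>L x - L y\<bar> \<le> 1 / l * \<bar>x - y\<bar>"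
    "\<And>s. (L has_real_derivative 1 / lam (max 0 (L s))) (at s)"
    "\<And>T. \<exists>S. \<forall>s. L s \<le> T \<longrightarrow> s \<le> S"
proof -
  \<comment> \<open>Continuing \<open>lam\<close> to negative times by its value at 0 makes its
    integral a bijection of the line.\<close>
  define lam' where "lam' = (\<lambda>t. lam (max 0 t))"
  have cont': "continuous_on UNIV lam'"
    unfolding lam'_def by (rule continuous_on_compose2[OF cont]) (auto intro!: continuous_intros)
  have l': "l \<le> lam' t" for t by (simp add: lam'_def l)
  have "\<exists>F. \<forall>x. - \<infinity> < ereal x \<longrightarrow> ereal x < \<infinity> \<longrightarrow> (F has_vector_derivative lam' x) (at x)"
    by (rule einterval_antiderivative) (use cont' in \<open>auto simp: continuous_on_eq_continuous_at\<close>)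
  then obtain F where F: "\<And>x. (F has_real_derivative lam' x) (at x)"
    by (auto simp: has_real_derivative_iff_has_vector_derivative)
  define La where "La = (\<lambda>t. F t - F 0)"
  have dLa: "(La has_real_derivative lam' x) (at x)" for x
    unfolding La_def using F by (auto intro!: derivative_eq_intros)
  have contLa: "continuous_on S La" for S
    by (rule continuous_at_imp_continuous_on) (use dLa DERIV_isCont in blast)
  have inc: "l * (y - x) \<le> La y - La x" if "x \<le> y" for x y
  proof -
    have "La x - l * x \<le> La y - l * y"
    proof (rule DERIV_nonneg_imp_nondecreasing[OF that])
      fix z
      have "((\<lambda>z. La z - l * z) has_real_derivative lam' z - l) (at z)"
        by (auto intro!: derivative_eq_intros dLa)
      then show "\<exists>y. ((\<lambda>z. La z - l * z) has_real_derivative y) (at z) \<and> 0 \<le> y"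
        using l'[of z] by (intro exI[of _ "lam' z - l"]) auto
    qed
    then show ?thesis by (simp add: algebra_simps)
  qed
  have "La 0 = 0" by (simp add: La_def)
  have "strict_mono La"
  proof (rule strict_monoI)
    fix x y :: real assume "x < y"
    then have "0 < l * (y - x)" using \<open>0 < l\<close> by simp
    also have "\<dots> \<le> La y - La x" using \<open>x < y\<close> by (intro inc) simp
    finally show "La x < La y" by simp
  qed
  moreover have "surj La"
  proof -
    have "\<exists>x. La x = s" for s
    proof -
      have "La (min 0 (s / l)) \<le> s"
        using inc[of "s / l" 0] \<open>0 < l\<close> \<open>La 0 = 0\<close> by (auto simp: min_def field_simps split: if_splits)
      moreover have "s \<le> La (max 0 (s / l))"
        using inc[of 0 "s / l"] \<open>0 < l\<close> \<open>La 0 = 0\<close> by (auto simp: max_def field_simps split: if_splits)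
      ultimately show ?thesis
        using IVT'[of La "min 0 (s / l)" s "max 0 (s / l)"] contLa by (metis max.cobounded1 min.cobounded1 order_trans)
    qed
    then show ?thesis by (metis surjI)
  qed
  ultimately have bij: "bij La" by (simp add: bij_def strict_mono_imp_inj_on)
  define L where "L = inv La"
  have LaL: "La (L s) = s" for s
    unfolding L_def by (rule surj_f_inv_f[OF \<open>surj La\<close>])
  have Lmono: "L x \<le> L y" if "x \<le> y" for x y
    using \<open>strict_mono La\<close> that LaL by (metis strict_mono_less_eq)
  show ?thesis
  proof
    show "L 0 = 0" using \<open>La 0 = 0\<close> bij unfolding L_def by (metis bij_inv_eq_iff)
    have lip: "\<bar>L x - L y\<bar> \<le> 1 / l * \<bar>x - y\<bar>" if "x \<le> y" for x y
      using inc[OF Lmono[OF that]] Lmono[OF that] that \<open>0 < l\<close> by (simp add: LaL field_simps)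
    then show "\<bar>L x - L y\<bar> \<le> 1 / l * \<bar>x - y\<bar>" for x y
      by (metis abs_minus_commute linear)
    show "(L has_real_derivative 1 / lam (max 0 (L s))) (at s)" for s
    proof -
      have "isCont L s" unfolding L_def by (rule isCont_inv[OF bij contLa])
      moreover have "lam' (L s) \<noteq> 0" using l'[of "L s"] \<open>0 < l\<close> by simp
      ultimately have "(L has_real_derivative inverse (lam' (L s))) (at s)"
        by (intro DERIV_inverse_function[OF dLa, where a = "s - 1" and b = "s + 1"]) (auto simp: LaL)
      then show ?thesis by (simp add: lam'_def inverse_eq_divide)
    qed
    have "s \<le> La T" if "L s \<le> T" for s T
      using \<open>strict_mono La\<close> that LaL by (metis strict_mono_less_eq)
    then show "\<exists>S. \<forall>s. L s \<le> T \<longrightarrow> s \<le> S" for T by blast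
  qed
qed

context finite_initial
begin

text \<open>In the subcritical case \<open>th y\<close> is the time at which the characteristic starting from \<open>y\<close> reaches \<open>0\<close>.
  Writing the self-consistency condition for \<open>th\<close> rather than for its inverse gives an equation with a
  Lipschitz right-hand side, as \<open>L\<close> is the inverse of the integral of \<open>lam\<close>.\<close>

lemma subcritical_arrival_time:
  fixes lam :: "real \<Rightarrow> real"
  assumes cont: "continuous_on {0..} lam" and "0 < l" and l: "\<And>t. 0 \<le> t \<Longrightarrow> l \<le> lam t"
  obtains th where "continuous_on {0..} th" "th 0 = 0"
    "\<And>y. 0 < y \<Longrightarrow> (th has_real_derivative (1 - th y * a y) / lam (th y)) (at y)"
    "\<And>y. 0 \<le> y \<Longrightarrow> 0 < 1 - th y * a y" "\<And>y. 0 \<le> y \<Longrightarrow> 0 \<le> th y"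
    "\<And>T. \<exists>y\<ge>0. T \<le> th y"
proof -
  obtain L where L: "L 0 = 0" "\<And>x y. \<bar>L x - L y\<bar> \<le> 1 / l * \<bar>x - y\<bar>"
    "\<And>s. (L has_real_derivative 1 / lam (max 0 (L s))) (at s)"
    "\<And>T. \<exists>S. \<forall>s. L s \<le> T \<longrightarrow> s \<le> S"
    by (rule inverse_of_cumulated_rate[OF cont \<open>0 < l\<close> l]) auto
  obtain th where contth: "continuous_on {0..} th"
    and th: "\<And>y. 0 \<le> y \<Longrightarrow> th y = L (y - integral {0..y} (\<lambda>z. th z * a z))"
    by (rule volterra_solution[OF L(2,1), of a "a 0"])
       (use \<open>0 < l\<close> in \<open>auto simp: a_nonneg a_antimono continuous_on_a\<close>)
  \<comment> \<open>\<open>tau y\<close> is the integral of \<open>lam\<close> up to the arrival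
    time \<open>th y\<close>. Its derivative \<open>n y\<close> is positive precisely if the arrival
    precedes the expiry of the characteristic.\<close>
  define tau where "tau = (\<lambda>y. y - integral {0..y} (\<lambda>z. th z * a z))"
  define n where "n = (\<lambda>y. 1 - th y * a y)"
  have th_tau: "th y = L (tau y)" if "0 \<le> y" for y using th[OF that] by (simp add: tau_def)
  have "th 0 = 0" using th_tau[of 0] L(1) by (simp add: tau_def)
  have contn: "continuous_on {0..} n"
    unfolding n_def by (intro continuous_intros contth continuous_on_a)
  have dtau: "(tau has_real_derivative n y) (at y)" if "0 < y" for y
  proof -
    have "continuous_on {0..y+1} (\<lambda>z. th z * a z)"
      by (intro continuous_intros continuous_on_a continuous_on_subset[OF contth]) auto
    then have "((\<lambda>y. integral {0..y} (\<lambda>z. th z * a z)) has_real_derivative th y * a y) (at y within {0..y+1})"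
      by (rule integral_has_real_derivative) (use that in auto)
    moreover have "at y within {0..y+1} = at y"
      using that by (intro at_within_interior) auto
    ultimately show ?thesis
      unfolding tau_def n_def by (auto intro!: derivative_eq_intros)
  qed
  have dth': "(th has_real_derivative n y / lam (max 0 (th y))) (at y)" if "0 < y" for y
  proof -
    have "((\<lambda>y. L (tau y)) has_real_derivative 1 / lam (max 0 (L (tau y))) * n y) (at y)"
      by (rule DERIV_chain2[OF L(3) dtau[OF that]])
    then have "((\<lambda>y. L (tau y)) has_real_derivative n y / lam (max 0 (th y))) (at y)"
      using th_tau[of y] that by simp
    then show ?thesis
      by (rule has_field_derivative_transform_within_open[of _ _ _ "{0<..}"]) (use that th_tau in auto)
  qed
  have th_nonneg': "0 \<le> th y" if "0 \<le> y" and pos: "\<And>x. 0 < x \<Longrightarrow> x < y \<Longrightarrow> 0 \<le> n x" for y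
  proof -
    have "th 0 \<le> th y"
    proof (rule DERIV_nonneg_imp_increasing_open[OF that(1)])
      fix x assume x: "0 < x" "x < y"
      have "0 \<le> n x / lam (max 0 (th x))"
        using pos[OF x] l[of "max 0 (th x)"] \<open>0 < l\<close> by (intro divide_nonneg_nonneg) auto
      with dth'[OF x(1)] show "\<exists>d. (th has_real_derivative d) (at x) \<and> 0 \<le> d" by blast
    qed (rule continuous_on_subset[OF contth], auto)
    with \<open>th 0 = 0\<close> show ?thesis by simp
  qed
  have npos: "0 < n y" if "0 \<le> y" for y
  proof (rule pos_by_first_zero[where f = n, OF contn _ _ that])
    show "0 < n 0" by (simp add: n_def \<open>th 0 = 0\<close>)
    fix s :: real assume s: "0 < s" and pos: "\<And>x. 0 \<le> x \<Longrightarrow> x < s \<Longrightarrow> 0 < n x"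
    \<comment> \<open>A Gronwall argument: the derivative \<open>- n * a / lam + th * b\<close> of
      \<open>n\<close> is at least \<open>- C * n\<close> as long as \<open>n\<close> is
      nonnegative, because then \<open>th\<close> is too.\<close>
    define C where "C = a 0 / l"
    have "n 0 * exp (C * 0) \<le> n s * exp (C * s)"
    proof (rule DERIV_nonneg_imp_increasing_open[where f = "\<lambda>x. n x * exp (C * x)"])
      fix x assume x: "0 < x" "x < s"
      define d where "d = n x / lam (max 0 (th x))"
      have "0 \<le> th x" using x pos by (intro th_nonneg') (auto simp: less_imp_le)
      have lx: "l \<le> lam (max 0 (th x))" by (simp add: l)
      have "d * a x \<le> C * n x"
      proof -
        have "d * a x = n x * (a x / lam (max 0 (th x)))" by (simp add: d_def)
        also have "\<dots> \<le> n x * C"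
          unfolding C_def using pos[of x] x lx \<open>0 < l\<close> a_nonneg[of 0]
          by (intro mult_left_mono frac_le a_antimono) auto
        finally show ?thesis by (simp add: mult.commute)
      qed
      then have "0 \<le> ((- (d * a x - th x * b x)) + C * n x) * exp (C * x)"
        using mult_nonneg_nonneg[OF \<open>0 \<le> th x\<close> b_nonneg[of x]] by (intro mult_nonneg_nonneg) auto
      moreover have "((\<lambda>x. n x * exp (C * x)) has_real_derivative ((- (d * a x - th x * b x)) + C * n x) * exp (C * x)) (at x)"
        unfolding n_def d_def
        by (rule derivative_eq_intros dth'[OF x(1)] a_has_derivative refl)+ (simp add: n_def algebra_simps)
      ultimately show "\<exists>y. ((\<lambda>x. n x * exp (C * x)) has_real_derivative y) (at x) \<and> 0 \<le> y" by blast
    qed (use s in \<open>auto intro!: continuous_intros continuous_on_subset[OF contn]\<close>)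
    then have "0 < n s * exp (C * s)" by (simp add: n_def \<open>th 0 = 0\<close>)
    then show "0 < n s" by (simp add: zero_less_mult_iff)
  qed
  have th_nonneg: "0 \<le> th y" if "0 \<le> y" for y
    using th_nonneg'[OF that] npos by (simp add: less_imp_le)
  show ?thesis
  proof
    show "(th has_real_derivative (1 - th y * a y) / lam (th y)) (at y)" if "0 < y" for y
      using dth'[OF that] th_nonneg[of y] that by (simp add: n_def max_absorb2)
    show "\<exists>y\<ge>0. T \<le> th y" for T
    proof (rule ccontr)
      assume "\<not> ?thesis"
      then have less: "th y < T" if "0 \<le> y" for y using that by force
      obtain S where S: "\<And>s. L s \<le> T \<Longrightarrow> s \<le> S" using L(4)[of T] by blast
      have bound: "y - T * U 0 \<le> S" if "0 \<le> y" for y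
      proof -
        \<comment> \<open>If \<open>th\<close> stayed below \<open>T\<close>, the derivative of
          \<open>tau\<close> would be at least \<open>1 - T * a\<close>, hence \<open>tau y\<close>
          at least \<open>y - T * U 0\<close>; but \<open>L (tau y) = th y\<close> bounds
          \<open>tau\<close>.\<close>
        have "tau 0 - 0 - T * U 0 \<le> tau y - y - T * U y"
        proof (rule DERIV_nonneg_imp_increasing_open[OF that, where f = "\<lambda>x. tau x - x - T * U x"])
          fix x assume x: "0 < x" "x < y"
          have "((\<lambda>x. tau x - x - T * U x) has_real_derivative n x - 1 - T * (- a x)) (at x)"
            by (rule derivative_eq_intros dtau[OF x(1)] U_has_derivative refl)+ simp
          moreover have "0 \<le> n x - 1 - T * (- a x)"
            using mult_right_mono[of "th x" T "a x"] less[of x] x a_nonneg[of x] by (simp add: n_def)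
          ultimately show "\<exists>d. ((\<lambda>x. tau x - x - T * U x) has_real_derivative d) (at x) \<and> 0 \<le> d" by blast
        next
          show "continuous_on {0..y} (\<lambda>x. tau x - x - T * U x)"
            unfolding tau_def
            by (intro continuous_on_diff continuous_on_mult continuous_on_const continuous_on_id continuous_on_U
                indefinite_integral_continuous_1 integrable_continuous_interval)
               (auto intro: continuous_on_a continuous_on_subset[OF contth])
        qed
        moreover have "0 \<le> T" using less[of 0] \<open>th 0 = 0\<close> by simp
        then have "0 \<le> T * U y" by (simp add: U_nonneg)
        moreover have "tau y \<le> S" using S[of "tau y"] th_tau[OF that] less[OF that] by simp
        moreover have "tau 0 = 0" by (simp add: tau_def)
        ultimately show ?thesis by simp
      qed
      from bound[of "max 0 (S + T * U 0 + 1)"] show False by auto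
    qed
  qed (use contth \<open>th 0 = 0\<close> npos th_nonneg in \<open>auto simp: n_def\<close>)
qed

text \<open>The starting point \<open>y\<close> is the inverse of the arrival time, which increases
  strictly because \<open>1 - th y * a y\<close> is positive.\<close>

lemma subcritical_existence:
  fixes lam :: "real \<Rightarrow> real"
  assumes cont: "continuous_on {0..} lam" and "0 < l" and l: "\<And>t. 0 \<le> t \<Longrightarrow> l \<le> lam t"
  shows "\<exists>v. subcrit_sol q lam v"
proof -
  obtain th where contth: "continuous_on {0..} th" and "th 0 = 0"
    and dth: "\<And>y. 0 < y \<Longrightarrow> (th has_real_derivative (1 - th y * a y) / lam (th y)) (at y)"
    and npos: "\<And>y. 0 \<le> y \<Longrightarrow> 0 < 1 - th y * a y" and th_nonneg: "\<And>y. 0 \<le> y \<Longrightarrow> 0 \<le> th y"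
    and unbounded: "\<And>T. \<exists>y\<ge>0. T \<le> th y"
    by (rule subcritical_arrival_time[OF assms]) blast+
  \<comment> \<open>Continuation with slope 1 to the negative axis makes the arrival time a
    bijection of the line.\<close>
  define f where "f = (\<lambda>y. th (max 0 y) + min 0 y)"
  have contf: "continuous_on UNIV f"
    unfolding f_def by (intro continuous_intros continuous_on_compose2[OF contth]) auto
  have th_strict: "th x < th y" if "0 \<le> x" "x < y" for x y
  proof (rule DERIV_pos_imp_increasing_open[OF that(2)])
    fix z assume z: "x < z" "z < y"
    then have "0 < (1 - th z * a z) / lam (th z)"
      using npos[of z] l[OF th_nonneg, of z] \<open>0 < l\<close> that by (intro divide_pos_pos) auto
    with dth[of z] z that show "\<exists>d. (th has_real_derivative d) (at z) \<and> 0 < d" by force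
  qed (rule continuous_on_subset[OF contth], use that in auto)
  have "strict_mono f"
  proof (rule strict_monoI)
    fix x y :: real assume xy: "x < y"
    consider "0 \<le> x" | "x < 0" "0 < y" | "y \<le> 0" using xy by linarith
    then show "f x < f y"
    proof cases
      case 1
      then show ?thesis using th_strict[of x y] xy by (simp add: f_def max_def min_def)
    next
      case 2
      then show ?thesis using th_nonneg[of y] \<open>th 0 = 0\<close> by (simp add: f_def max_def min_def)
    next
      case 3
      then show ?thesis using xy by (simp add: f_def max_def min_def)
    qed
  qed
  moreover have "surj f"
  proof -
    have "\<exists>x. f x = s" for s
    proof -
      obtain y where y: "0 \<le> y" "s \<le> th y" using unbounded by blast
      have "f (min 0 s) \<le> s" using \<open>th 0 = 0\<close> by (simp add: f_def)
      moreover have "s \<le> f y" using y by (simp add: f_def max_def)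
      moreover have "min 0 s \<le> y" using y(1) by simp
      ultimately show ?thesis
        using IVT'[of f "min 0 s" s y] continuous_on_subset[OF contf] by blast
    qed
    then show ?thesis by (metis surjI)
  qed
  ultimately have bij: "bij f" by (simp add: bij_def strict_mono_imp_inj_on)
  define y where "y = inv f"
  have fy: "f (y t) = t" for t unfolding y_def by (rule surj_f_inv_f[OF \<open>surj f\<close>])
  have contUy: "continuous_on S (\<lambda>t. U (y t))" and conty: "continuous_on S y" for S
  proof -
    show "continuous_on S y"
      unfolding y_def using isCont_inv[OF bij contf] by (auto intro: continuous_at_imp_continuous_on)
    then show "continuous_on S (\<lambda>t. U (y t))"
      by (rule continuous_on_compose2[OF continuous_on_U[of UNIV]]) auto
  qed
  have ypos: "0 < y t" if "0 < t" for t
    using fy[of t] that \<open>th 0 = 0\<close> by (cases "0 < y t") (auto simp: f_def max_def min_def split: if_splits)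
  have "f 0 = 0" by (simp add: f_def \<open>th 0 = 0\<close>)
  then have "y 0 = 0" using bij unfolding y_def by (metis bij_inv_eq_iff)
  have ynonneg: "0 \<le> y t" if "0 \<le> t" for t
    using ypos[of t] \<open>y 0 = 0\<close> that by (cases "t = 0") auto
  have thy: "th (y t) = t" if "0 \<le> t" for t
    using fy[of t] ynonneg[OF that] by (simp add: f_def max_def)
  define G where "G = (\<lambda>t. y t + t * U (y t))"
  have "subcrit_sol q lam (\<lambda>t k. exp (- real k * G t) * flory q k t)"
  proof (rule subcrit_solI[where y = y])
    show "t * a (y t) \<le> 1" if "0 \<le> t" for t
      using npos[OF ynonneg[OF that]] thy[OF that] by simp
    show "continuous_on {0..} G"
      unfolding G_def by (intro continuous_intros conty contUy)
    fix t :: real assume t: "0 < t"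
    define n where "n = 1 - t * a (y t)"
    have n: "0 < n" using npos[OF ynonneg, of t] thy[of t] t by (simp add: n_def)
    have lt: "0 < lam t" using l[of t] \<open>0 < l\<close> t by simp
    have "(f has_real_derivative n / lam t) (at (y t))"
    proof (rule has_field_derivative_transform_within_open[of th _ _ "{0<..}"])
      show "(th has_real_derivative n / lam t) (at (y t))"
        using dth[OF ypos[OF t]] thy[of t] t by (simp add: n_def)
    qed (use ypos[OF t] in \<open>auto simp: f_def max_def\<close>)
    moreover have "isCont y t"
      using conty[of UNIV] by (simp add: continuous_on_eq_continuous_at)
    ultimately have "(y has_real_derivative inverse (n / lam t)) (at t)"
      using n lt by (intro DERIV_inverse_function[where f = f and a = "t - 1" and b = "t + 1"]) (auto simp: fy)
    then have dy: "(y has_real_derivative lam t / n) (at t)" by simp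
    have dUy: "((\<lambda>t. U (y t)) has_real_derivative - a (y t) * (lam t / n)) (at t)"
      by (rule DERIV_chain2[OF U_has_derivative dy])
    \<comment> \<open>Since \<open>y\<close> has derivative \<open>lam t / n\<close> with
      \<open>n = 1 - t * a (y t)\<close>, its contributions to the derivative of \<open>G\<close>
      sum to \<open>lam t\<close>.\<close>
    have "(G has_real_derivative lam t / n + (1 * U (y t) + - a (y t) * (lam t / n) * t)) (at t)"
      unfolding G_def by (intro DERIV_add DERIV_mult dy dUy DERIV_ident)
    also have "lam t / n + (1 * U (y t) + - a (y t) * (lam t / n) * t) = U (y t) + (lam t / n) * (1 - t * a (y t))"
      by (simp add: algebra_simps)
    also have "\<dots> = U (y t) + lam t"
      using n by (simp add: n_def[symmetric])
    finally show "(G has_real_derivative U (y t) + lam t) (at t)" .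
  qed (use \<open>y 0 = 0\<close> in \<open>auto simp: G_def\<close>)
  then show ?thesis by blast
qed

end

section \<open>The alternating equations\<close>

text \<open>A bounded strictly increasing sequence converges to a limit outside its range, hence to
  an accumulation point.\<close>

lemma burning_times_unbounded:
  fixes \<beta> :: "nat \<Rightarrow> real"
  assumes "strict_mono \<beta>" "\<forall>x. \<not> x islimpt range \<beta>"
  shows "\<exists>i. t \<le> \<beta> i"
proof (rule ccontr)
  assume "\<nexists>i. t \<le> \<beta> i"
  then have "\<beta> i \<le> t" for i by (metis linear)
  moreover have "incseq \<beta>" using assms(1) by (rule strict_mono_mono)
  ultimately obtain x where x: "\<beta> \<longlonglongrightarrow> x" "\<And>i. \<beta> i \<le> x"
    using incseq_convergent[of \<beta> t] by blast
  have "\<beta> i \<noteq> x" for i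
    using x(2)[of "Suc i"] strict_monoD[OF assms(1), of i "Suc i"] by simp
  then have "x islimpt range \<beta>"
    unfolding islimpt_sequential using x(1) by (intro exI[of _ \<beta>]) auto
  with assms(2) show False by blast
qed

text \<open>The strict inequality in \<open>Midx\<close> makes the periods closed on the right: at a
  burning time the previous index is still in force.\<close>

lemma Midx_eq:
  assumes "strict_mono \<beta>" "\<beta> i < s" "s \<le> \<beta> (Suc i)"
  shows "Midx \<beta> s = i"
proof -
  have "{j. \<beta> j < s} = {..i}"
  proof (intro set_eqI iffI)
    fix j assume "j \<in> {j. \<beta> j < s}"
    then have "\<beta> j < \<beta> (Suc i)" using assms(3) by simp
    then show "j \<in> {..i}" using assms(1) by (simp add: strict_mono_less)
  next
    fix j assume "j \<in> {..i}"
    then have "\<beta> j \<le> \<beta> i" using assms(1) by (simp add: strict_mono_less_eq)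
    with assms(2) show "j \<in> {j. \<beta> j < s}" by simp
  qed
  then show ?thesis
    unfolding Midx_def by (auto intro: Max_eqI)
qed

lemma burning_times_interval:
  fixes \<beta> :: "nat \<Rightarrow> real"
  assumes "strict_mono \<beta>" "\<forall>x. \<not> x islimpt range \<beta>" "\<beta> 0 \<le> t"
  obtains i where "\<beta> i \<le> t" "t \<le> \<beta> (Suc i)"
proof -
  define j where "j = (LEAST j. t \<le> \<beta> (Suc j))"
  have "\<exists>j. t \<le> \<beta> (Suc j)"
    using burning_times_unbounded[OF assms(1,2), of t] strict_monoD[OF assms(1) lessI]
    by (meson less_imp_le order_trans)
  then have j: "t \<le> \<beta> (Suc j)" unfolding j_def by (rule LeastI_ex)
  have "\<beta> j \<le> t"
  proof (cases j)
    case (Suc i)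
    then have "\<not> t \<le> \<beta> (Suc i)" using not_less_Least[of i "\<lambda>j. t \<le> \<beta> (Suc j)"] by (simp add: j_def)
    then show ?thesis using Suc by simp
  qed (use assms in simp)
  with j that show ?thesis by blast
qed

text \<open>Constant-rate flows are glued together: the sequence reached at a burning time is the
  initial data of the next flow, and its mass is the next rate.\<close>

lemma alternating_existence:
  assumes v0: "in_N v0" and \<beta>: "\<beta> 0 = 0" "strict_mono \<beta>" "\<forall>x. \<not> x islimpt range \<beta>"
  shows "\<exists>v. alt_sol v0 \<beta> v"
proof -
  define x where "x = rec_nat v0 (\<lambda>i y. flow y (m0 y) (\<beta> (Suc i) - \<beta> i))"
  have x0: "x 0 = v0" and xSuc: "x (Suc i) = flow (x i) (m0 (x i)) (\<beta> (Suc i) - \<beta> i)" for i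
    by (simp_all add: x_def)
  have \<beta>_less: "\<beta> i < \<beta> (Suc i)" for i using \<beta>(2) by (simp add: strict_monoD)
  have flow_N: "in_N (flow y (m0 y) t)" if "in_N y" "0 \<le> t" for y t
  proof -
    have "0 \<le> y k" if "k \<ge> 1" for k using \<open>in_N y\<close> that by (simp add: in_N_def)
    then show ?thesis
      using flow_nonneg[of y t] part_flow_le[of y "m0 y" t] part_le_m0[OF \<open>in_N y\<close>] \<open>0 \<le> t\<close>
      by (intro in_NI_bounded[of _ "m0 y"]) auto
  qed
  have xN: "in_N (x i)" for i
    by (induction i) (use v0 flow_N \<beta>_less in \<open>auto simp: x0 xSuc less_imp_le\<close>)
  define piece where "piece = (\<lambda>i t. flow (x i) (m0 (x i)) (t - \<beta> i))"
  \<comment> \<open>For t <= 0 \<open>Midx\<close> is the maximum of an empty set, so the value is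
    prescribed separately.\<close>
  define v where "v = (\<lambda>t. if t \<le> 0 then v0 else piece (Midx \<beta> t) t)"
  \<comment> \<open>At the left end, if i > 0, \<open>Midx\<close> selects the preceding piece,
    which ends where piece \<open>i\<close> begins.\<close>
  have v_piece: "v t = piece i t" if t: "\<beta> i \<le> t" "t \<le> \<beta> (Suc i)" for i t
  proof (cases "t = \<beta> i")
    case True
    show ?thesis
    proof (cases i)
      case 0
      then show ?thesis using True \<beta>(1) by (simp add: v_def piece_def x0)
    next
      case (Suc j)
      have "0 < \<beta> i" using strict_monoD[OF \<beta>(2), of 0 i] \<beta>(1) Suc by simp
      moreover have "Midx \<beta> t = j"
        using Midx_eq[OF \<beta>(2)] True \<beta>_less Suc by simp
      ultimately show ?thesis using True Suc by (simp add: v_def piece_def xSuc)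
    qed
  next
    case False
    then have "\<beta> i < t" using t by simp
    moreover have "0 \<le> \<beta> i" using strict_mono_less_eq[OF \<beta>(2), of 0 i] \<beta>(1) by simp
    ultimately show ?thesis using Midx_eq[OF \<beta>(2) _ t(2)] by (simp add: v_def)
  qed
  have v\<beta>: "v (\<beta> i) = x i" for i
    using v_piece[of i "\<beta> i"] \<beta>_less[of i] by (simp add: piece_def)
  define f where "f = (\<lambda>k s. coag (v s) k - real k * v s k * m0 (v (\<beta> (Midx \<beta> s))))"
  \<comment> \<open>Only derivatives in the open interval enter; at \<open>\<beta> i\<close> itself
    the integrand may carry another rate.\<close>
  have local: "(f k has_integral (v t k - v (\<beta> i) k)) {\<beta> i..t}" if t: "\<beta> i \<le> t" "t \<le> \<beta> (Suc i)" for i t k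
  proof (rule fundamental_theorem_of_calculus_interior[OF t(1)])
    have "continuous_on {\<beta> i..t} (\<lambda>s. piece i s k)"
      unfolding piece_def by (rule continuous_on_compose2[OF continuous_on_flow]) (auto intro!: continuous_intros)
    then show "continuous_on {\<beta> i..t} (\<lambda>s. v s k)"
    proof (rule continuous_on_eq)
      show "piece i r k = v r k" if "r \<in> {\<beta> i..t}" for r
        using v_piece[of i r] that t by simp
    qed
    fix s assume s: "s \<in> {\<beta> i<..<t}"
    have "((\<lambda>s. piece i s k) has_real_derivative
        (coag (piece i s) k - real k * piece i s k * m0 (x i)) * 1) (at s)"
      unfolding piece_def
      by (rule DERIV_chain2[OF flow_has_derivative]) (use s in \<open>auto intro!: derivative_eq_intros\<close>)
    moreover have "(coag (piece i s) k - real k * piece i s k * m0 (x i)) * 1 = f k s"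
      using s t v_piece[of i s] Midx_eq[OF \<beta>(2), of i s] by (simp add: f_def v\<beta>)
    ultimately have "((\<lambda>s. piece i s k) has_real_derivative f k s) (at s)" by simp
    then have "((\<lambda>s. v s k) has_real_derivative f k s) (at s)"
    proof (rule has_field_derivative_transform_within_open[of _ _ _ "{\<beta> i<..<t}"])
      show "piece i r k = v r k" if "r \<in> {\<beta> i<..<t}" for r
        using v_piece[of i r] that t by simp
    qed (use s in auto)
    then show "((\<lambda>s. v s k) has_vector_derivative f k s) (at s)"
      by (simp add: has_real_derivative_iff_has_vector_derivative)
  qed
  have \<beta>_nonneg: "0 \<le> \<beta> i" for i using strict_mono_less_eq[OF \<beta>(2), of 0 i] \<beta>(1) by simp
  have upto: "(f k has_integral (v (\<beta> i) k - v0 k)) {0..\<beta> i}" for i k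
  proof (induction i)
    case 0
    then show ?case by (simp add: \<beta>(1) v_def has_integral_refl)
  next
    case (Suc i)
    have "(f k has_integral ((v (\<beta> i) k - v0 k) + (v (\<beta> (Suc i)) k - v (\<beta> i) k))) {0..\<beta> (Suc i)}"
      by (rule has_integral_combine[OF \<beta>_nonneg _ Suc local]) (use \<beta>_less[of i] in auto)
    then show ?case by simp
  qed
  have "in_N (v t) \<and> (\<forall>k\<ge>1. (f k has_integral (v t k - v0 k)) {0..t})" if t: "0 \<le> t" for t
  proof -
    obtain i where i: "\<beta> i \<le> t" "t \<le> \<beta> (Suc i)"
      using burning_times_interval[OF \<beta>(2,3), of t] t \<beta>(1) by auto
    have "in_N (v t)" using v_piece[OF i] flow_N[OF xN, of "t - \<beta> i" i] i by (simp add: piece_def)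
    moreover have "(f k has_integral ((v (\<beta> i) k - v0 k) + (v t k - v (\<beta> i) k))) {0..t}" for k
      by (rule has_integral_combine[OF \<beta>_nonneg i(1) upto local[OF i]])
    ultimately show ?thesis by simp
  qed
  then show ?thesis
    unfolding alt_sol_def f_def by blast
qed

section \<open>Uniqueness for the alternating equations\<close>

lemma alt_sol_initial:
  assumes "alt_sol v0 \<beta> w" "k \<ge> 1"
  shows "w 0 k = v0 k"
proof -
  have "((\<lambda>s. coag (w s) k - real k * w s k * m0 (w (\<beta> (Midx \<beta> s)))) has_integral (w 0 k - v0 k)) {0..0}"
    using assms unfolding alt_sol_def by auto
  from has_integral_unique[OF this, of 0] show ?thesis by (simp add: has_integral_refl)
qed

lemma alt_sol_eq_flow:
  assumes w: "alt_sol v0 \<beta> w" and \<beta>: "\<beta> 0 = 0" "strict_mono \<beta>"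
    and t: "\<beta> i \<le> t" "t \<le> \<beta> (Suc i)" and "k \<ge> 1"
  shows "w t k = flow (w (\<beta> i)) (m0 (w (\<beta> i))) (t - \<beta> i) k"
proof -
  define c where "c = m0 (w (\<beta> i))"
  let ?f = "\<lambda>k s. coag (w s) k - real k * w s k * m0 (w (\<beta> (Midx \<beta> s)))"
  have I: "(?f k has_integral (w t k - w 0 k)) {0..t}" if "0 \<le> t" "k \<ge> 1" for t k
    using w that alt_sol_initial[OF w that(2)] unfolding alt_sol_def by auto
  have \<beta>_nonneg: "0 \<le> \<beta> i" using strict_mono_less_eq[OF \<beta>(2), of 0 i] \<beta>(1) by simp
  have "w t k = exp (- real k * (c * (t - \<beta> i))) * flory (w (\<beta> i)) k (t - \<beta> i)"
  proof (rule solution_eq_flory[where g = "\<lambda>_. c" and a = "\<beta> i" and b = "\<beta> (Suc i)" and G = "\<lambda>t. c * (t - \<beta> i)"])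
    fix u k assume u: "u \<in> {\<beta> i..\<beta> (Suc i)}" and k: "1 \<le> (k::nat)"
    have "(?f k has_integral (w u k - w (\<beta> i) k)) {\<beta> i..u}"
      by (rule has_integral_subinterval[of 0 u _ "\<lambda>s. w s k"]) (use I k u \<beta>_nonneg in auto)
    then show "((\<lambda>s. coag (w s) k - real k * w s k * c) has_integral (w u k - w (\<beta> i) k)) {\<beta> i..u}"
    \<comment> \<open>The rate at the left end may differ from \<open>c\<close>, but a single point
      does not affect the integral.\<close>
    proof (rule has_integral_spike_finite[rotated 2, where S = "{\<beta> i}"])
      fix s assume "s \<in> {\<beta> i..u} - {\<beta> i}"
      then have "Midx \<beta> s = i" using u by (intro Midx_eq[OF \<beta>(2)]) auto
      then show "coag (w s) k - real k * w s k * c = ?f k s" by (simp add: c_def)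
    qed simp
  next
    fix s
    show "((\<lambda>t. c * (t - \<beta> i)) has_real_derivative c) (at s within {s..\<beta> (Suc i)})"
      by (auto intro!: derivative_eq_intros)
  qed (use t \<open>k \<ge> 1\<close> in \<open>auto intro!: continuous_intros\<close>)
  then show ?thesis by (simp add: flow_def c_def)
qed

text \<open>Agreement at a burning time fixes the initial data and the rate of the next period, so
  it propagates by induction.\<close>

lemma alt_sol_unique:
  assumes u: "alt_sol v0 \<beta> u" and w: "alt_sol v0 \<beta> w"
    and \<beta>: "\<beta> 0 = 0" "strict_mono \<beta>" "\<forall>x. \<not> x islimpt range \<beta>" and t: "0 \<le> t" "k \<ge> 1"
  shows "u t k = w t k"
proof -
  have step: "u t k = w t k"
    if eq: "\<And>k. k \<ge> 1 \<Longrightarrow> u (\<beta> i) k = w (\<beta> i) k" and "\<beta> i \<le> t" "t \<le> \<beta> (Suc i)" "k \<ge> 1" for i t k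
    using alt_sol_eq_flow[OF u \<beta>(1,2) that(2-4)] alt_sol_eq_flow[OF w \<beta>(1,2) that(2-4)]
      m0_cong[OF eq] flory_cong[OF eq that(4)] by (simp add: flow_def)
  have node: "u (\<beta> i) k = w (\<beta> i) k" if "k \<ge> 1" for i k
    using that
  proof (induction i arbitrary: k)
    case 0
    then show ?case using alt_sol_initial[OF u] alt_sol_initial[OF w] \<beta>(1) by simp
  next
    case (Suc i)
    show ?case
      by (rule step[OF Suc.IH]) (use Suc.prems strict_monoD[OF \<beta>(2), of i "Suc i"] in auto)
  qed
  obtain i where "\<beta> i \<le> t" "t \<le> \<beta> (Suc i)"
    using burning_times_interval[OF \<beta>(2,3), of t] t \<beta>(1) by auto
  then show ?thesis using step[OF node] t by blast
qed

lemma crit_sol_conv_subcrit_sol: "crit_sol v0 = subcrit_sol v0 (\<lambda>_. 0)"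
  by (simp add: fun_eq_iff crit_sol_def subcrit_sol_def)

theorem theorem1:
  fixes v0 :: "nat \<Rightarrow> real"
  assumes "in_Nstar v0"
  shows "(\<forall>(lam :: real \<Rightarrow> real) (linf :: real).
            continuous_on {0..} lam \<and> 0 < linf \<and> (\<forall>t\<ge>0. linf \<le> lam t)
            \<longrightarrow> unique_sol (subcrit_sol v0 lam))
       \<and> unique_sol (crit_sol v0)
       \<and> (\<forall>\<beta> :: nat \<Rightarrow> real. \<beta> 0 = 0 \<and> strict_mono \<beta> \<and> (\<forall>x. \<not> x islimpt range \<beta>)
            \<longrightarrow> unique_sol (alt_sol v0 \<beta>))"
proof (intro conjI allI impI)
  have N: "in_N v0" and fin: "finite {k. 1 \<le> k \<and> v0 k \<noteq> 0}"
    using assms by (auto simp: in_Nstar_def)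
  have nonneg: "0 \<le> v0 k" if "k \<ge> 1" for k using N that by (simp add: in_N_def)
  \<comment> \<open>The inserted 0 gives \<open>Max\<close> a value when \<open>v0\<close> vanishes
    at all indices k >= 1.\<close>
  interpret finite_initial v0 "Max (insert 0 {k. 1 \<le> k \<and> v0 k \<noteq> 0})"
  proof
    fix k assume less: "Max (insert 0 {k. 1 \<le> k \<and> v0 k \<noteq> 0}) < k"
    show "v0 k = 0"
    proof (rule ccontr)
      assume "v0 k \<noteq> 0"
      with less have "k \<in> insert 0 {k. 1 \<le> k \<and> v0 k \<noteq> 0}" by auto
      then have "k \<le> Max (insert 0 {k. 1 \<le> k \<and> v0 k \<noteq> 0})" using fin by (intro Max_ge) auto
      with less show False by simp
    qed
  qed (rule nonneg)
  show "unique_sol (crit_sol v0)"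
  proof -
    obtain v where v: "subcrit_sol v0 (\<lambda>_. 0) v" using critical_existence by blast
    moreover have "w t k = v t k" if "subcrit_sol v0 (\<lambda>_. 0) w" "0 \<le> t" "k \<ge> 1" for w t k
      by (rule subcrit_sol_unique[OF that(1) v _ _ nonneg that(2,3)]) auto
    ultimately show ?thesis unfolding unique_sol_def crit_sol_conv_subcrit_sol by blast
  qed
  show "unique_sol (subcrit_sol v0 lam)"
    if lam: "continuous_on {0..} lam \<and> 0 < linf \<and> (\<forall>t\<ge>0. linf \<le> lam t)" for lam linf
  proof -
    obtain v where v: "subcrit_sol v0 lam v"
      using subcritical_existence[of lam linf] lam by auto
    moreover have "w t k = v t k" if "subcrit_sol v0 lam w" "0 \<le> t" "k \<ge> 1" for w t k
      by (rule subcrit_sol_unique[OF that(1) v _ _ nonneg that(2,3)]) (use lam in force)+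
    ultimately show ?thesis unfolding unique_sol_def by blast
  qed
  show "unique_sol (alt_sol v0 \<beta>)"
    if "\<beta> 0 = 0 \<and> strict_mono \<beta> \<and> (\<forall>x. \<not> x islimpt range \<beta>)" for \<beta> :: "nat \<Rightarrow> real"
    unfolding unique_sol_def
    using alternating_existence[OF N] alt_sol_unique that by blast
qed

end
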